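(* Let $(\mathcal{M},\phi,\xi,\eta,g)$ be an $\mathcal{F}_i$-manifold for some $i\in\{1,\dots,11\}$ (an almost paracontact almost paracomplex Riemannian manifold of dimension $2n+1$ in the basic class $\mathcal{F}_i$). Then the tensors $\widehat N^{(1)},\widehat N^{(2)},\widehat N^{(3)},\widehat N^{(4)}$ have the following form in the respective cases. - $i=1$: $\widehat N^{(1)}(x,y,z)=\frac2n\{g(x,\phi y)\theta(\phi^2z)-g(\phi x,\phi y)\theta(\phi z)\}$, $\widehat N^{(2)}=0$, $\widehat N^{(3)}=0$, $\widehat N^{(4)}=0$. - $i=2$: $\widehat N^{(1)}(x,y,z)=-2\{F(\phi x,\phi y,\phi z)+F(\phi^2x,\phi^2y,\phi z)\}$, $\widehat N^{(2)}=0$, $\widehat N^{(3)}=0$, $\widehat N^{(4)}=0$. - $i=3$ and $i=7$: $\widehat N^{(1)}=0$, $\widehat N^{(2)}=0$, $\widehat N^{(3)}=0$, $\widehat N^{(4)}=0$. - $i=4$: $\widehat N^{(1)}(x,y,z)=\frac2n\theta(\xi)g(x,\phi y)\eta(z)$, $\widehat N^{(2)}(x,y)=-\frac2n\theta(\xi)g(\phi x,\phi y)$, $\widehat N^{(3)}=0$, $\widehat N^{(4)}=0$. - $i=5$: $\widehat N^{(1)}(x,y,z)=\frac2n\theta^*(\xi)g(\phi x,\phi y)\eta(z)$, $\widehat N^{(2)}(x,y)=-\frac2n\theta^*(\xi)g(x,\phi y)$, $\widehat N^{(3)}=0$, $\widehat N^{(4)}=0$. - $i=6$: $\widehat N^{(1)}(x,y,z)=4F(x,\phi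 y,\xi)\eta(z)$, $\widehat N^{(2)}(x,y)=-4F(x,y,\xi)$, $\widehat N^{(3)}=0$, $\widehat N^{(4)}=0$. - $i=8$ and $i=9$: $\widehat N^{(1)}(x,y,z)=-2\{\eta(x)F(y,\phi z,\xi)+\eta(y)F(x,\phi z,\xi)\}$, $\widehat N^{(2)}=0$, $\widehat N^{(3)}(x,y)=2F(x,y,\xi)$, $\widehat N^{(4)}=0$. - $i=10$: $\widehat N^{(1)}(x,y,z)=-\eta(x)F(\xi,y,\phi z)-\eta(y)F(\xi,x,\phi z)$, $\widehat N^{(2)}=0$, $\widehat N^{(3)}(x,y)=F(\xi,x,y)$, $\widehat N^{(4)}=0$. - $i=11$: $\widehat N^{(1)}(x,y,z)=\eta(z)\{\eta(x)\omega(\phi y)+\eta(y)\omega(\phi x)\}-2\eta(x)\eta(y)\omega(\phi z)$, $\widehat N^{(2)}(x,y)=-\eta(x)\omega(y)-\eta(y)\omega(x)$, $\widehat N^{(3)}(x,y)=\omega(x)\eta(y)+2\eta(x)\omega(y)$, $\widehat N^{(4)}(x)=-\omega(\phi x)$.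
   Context: Let $n\ge 1$. An almost paracontact almost paracomplex Riemannian manifold $(\mathcal{M},\phi,\xi,\eta,g)$ is a $(2n+1)$-dimensional smooth manifold with a $(1,1)$-tensor field $\phi$, a vector field $\xi$ and a 1-form $\eta$ such that $\phi\xi=0$, $\phi^2=I-\eta\otimes\xi$, $\eta\circ\phi=0$, $\eta(\xi)=1$, $\mathrm{tr}\,\phi=0$, and a Riemannian metric $g$ with $g(\phi x,\phi y)=g(x,y)-\eta(x)\eta(y)$, $g(x,\xi)=\eta(x)$. With $\nabla$ the Levi-Civita connection of $g$, the fundamental tensor is $F(x,y,z)=g((\nabla_x\phi)y,z)$. Associated Nijenhuis tensors: put $\{x,y\}=\nabla_xy+\nabla_yx$, $\{\phi,\phi\}(x,y)=\{\phi x,\phi y\}+\phi^2\{x,y\}-\phi\{\phi x,y\}-\phi\{x,\phi y\}$ and $(\mathfrak{L}_\xi g)(x,y)=(\nabla_x\eta)y+(\nabla_y\eta)x$. Then $\widehat N^{(1)}(x,y)=\{\phi,\phi\}(x,y)-(\mathfrak{L}_\xi g)(x,y)\xi$, $\widehat N^{(2)}(x,y)=(\mathfrak{L}_\xi g)(\phi x,y)+(\mathfrak{L}_\xi g)(x,\phi y)$, $\widehat N^{(3)}(x)=\{\phi x,\xi\}-\phi\{x,\xi\}$, $\widehat N^{(4)}(x)=(\mathfrak{L}_\xi g)(x,\xi)$; also $\widehat N^{(1)}(x,y,z)=g(\widehat N^{(1)}(x,y),z)$ and $\widehat N^{(3)}(x,y)=g(\widehat N^{(3)}(x),y)$. Lee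 forms: for an orthonormal basis $e_1,\dots,e_{2n}$ of $\ker\eta$ at a point, $\theta(z)=\sum_{i=1}^{2n}F(e_i,e_i,z)$, $\theta^*(z)=\sum_{i=1}^{2n}F(e_i,\phi e_i,z)$, $\omega(z)=F(\xi,\xi,z)$. Components of $F$. For a $(0,2)$-tensor $S$ put $[S](x,y,z)=S(x,y)\eta(z)+S(x,z)\eta(y)$; put $b(x,y)=F(\phi^2x,\phi^2y,\xi)$ and $c(x,y)=F(\phi x,\phi y,\xi)$. Then $F_1(x,y,z)=\frac1{2n}\{g(\phi x,\phi y)\theta(\phi^2z)+g(\phi x,\phi z)\theta(\phi^2y)-g(x,\phi y)\theta(\phi z)-g(x,\phi z)\theta(\phi y)\}$; $F_2(x,y,z)=\frac14\{2F(\phi^2x,\phi^2y,\phi^2z)+F(\phi^2y,\phi^2z,\phi^2x)+F(\phi^2z,\phi^2x,\phi^2y)-F(\phi y,\phi z,\phi^2x)-F(\phi z,\phi y,\phi^2x)\}-F_1(x,y,z)$; $F_3(x,y,z)=\frac14\{2F(\phi^2x,\phi^2y,\phi^2z)-F(\phi^2y,\phi^2z,\phi^2x)-F(\phi^2z,\phi^2x,\phi^2y)+F(\phi y,\phi z,\phi^2x)+F(\phi z,\phi y,\phi^2x)\}$; $F_4=\frac{\theta(\xi)}{2n}[S]$ with $S(x,y)=g(\phi x,\phi y)$; $F_5=\frac{\theta^*(\xi)}{2n}[S]$ with $S(x,y)=g(x,\phi y)$; $F_6=\frac14[S]-F_4-F_5$ with $S(x,y)=b(x,y)+b(y,x)+c(x,y)+c(y,x)$;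 $F_7=\frac14[S]$ with $S(x,y)=b(x,y)-b(y,x)+c(x,y)-c(y,x)$; $F_8=\frac14[S]$ with $S(x,y)=b(x,y)+b(y,x)-c(x,y)-c(y,x)$; $F_9=\frac14[S]$ with $S(x,y)=b(x,y)-b(y,x)-c(x,y)+c(y,x)$; $F_{10}(x,y,z)=\eta(x)F(\xi,\phi^2y,\phi^2z)$; $F_{11}(x,y,z)=\eta(x)\{\eta(y)\omega(z)+\eta(z)\omega(y)\}$. The manifold is an $\mathcal{F}_i$-manifold (belongs to the basic class $\mathcal{F}_i$) if $F=F_i$. *)

theory Defs
  imports "HOL-Analysis.Analysis" "HOL-Library.Function_Algebras"
begin

text \<open>
  Together with \<^theory>\<open>HOL-Library.Function_Algebras\<close> the following instance makes tangent
  vectors, vector fields and smooth functions, which are all functions below, real vector spaces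
  (and the smooth functions a ring) under the pointwise operations.
\<close>

instantiation "fun" :: (type, real_vector) real_vector
begin

definition scaleR_fun :: "real \<Rightarrow> ('a \<Rightarrow> 'b) \<Rightarrow> 'a \<Rightarrow> 'b" where
  "scaleR_fun c f = (\<lambda>x. c *\<^sub>R f x)"

instance
  by standard
    (simp_all add: scaleR_fun_def fun_eq_iff scaleR_add_right scaleR_add_left)

end

lemma scaleR_fun_apply [simp]: "(c *\<^sub>R f) x = c *\<^sub>R f x"
  by (simp add: scaleR_fun_def)


section \<open>Smooth manifolds\<close>

text \<open>\<open>Ck_on\<close> and \<open>smooth_on\<close> are meant for open sets only: they use the derivative \<open>at x\<close>.\<close>

primrec Ck_on :: "nat \<Rightarrow> 'a::real_normed_vector set \<Rightarrow> ('a \<Rightarrow> 'b::real_normed_vector) \<Rightarrow> bool" where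
  "Ck_on 0 S f \<longleftrightarrow> continuous_on S f"
| "Ck_on (Suc k) S f \<longleftrightarrow>
     (\<forall>x\<in>S. f differentiable (at x)) \<and>
     (\<forall>v. Ck_on k S (\<lambda>x. frechet_derivative f (at x) v))"

definition smooth_on :: "'a::real_normed_vector set \<Rightarrow> ('a \<Rightarrow> 'b::real_normed_vector) \<Rightarrow> bool" where
  "smooth_on S f \<longleftrightarrow> (\<forall>k. Ck_on k S f)"

text \<open>
  A manifold is a whole type \<open>'m\<close> (Hausdorff and second countable) with an atlas of charts
  \<open>(U, h)\<close> into a Euclidean space \<open>'e\<close>; its dimension is \<open>DIM('e)\<close>.
  The map \<open>h\<close> is only relevant on \<open>U\<close>. Atlases need not be maximal.
\<close>

type_synonym ('m, 'e) atlas = "('m set \<times> ('m \<Rightarrow> 'e)) set"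

definition smooth_atlas ::
    "('m::{t2_space,second_countable_topology}, 'e::euclidean_space) atlas \<Rightarrow> bool" where
  "smooth_atlas A \<longleftrightarrow>
     (\<forall>(U, h)\<in>A. open U \<and> open (h ` U) \<and> (\<exists>k. homeomorphism U (h ` U) h k)) \<and>
     (\<Union>(U, h)\<in>A. U) = UNIV \<and>
     (\<forall>(U, h)\<in>A. \<forall>(V, k)\<in>A. smooth_on (h ` (U \<inter> V)) (k \<circ> inv_into U h))"

definition smooth_functions ::
    "('m::{t2_space,second_countable_topology}, 'e::euclidean_space) atlas \<Rightarrow> ('m \<Rightarrow> real) set" where
  "smooth_functions A = {f. \<forall>(U, h)\<in>A. smooth_on (h ` U) (f \<circ> inv_into U h)}"

text \<open>
  Tangent vectors at \<open>p\<close> are the derivations at \<open>p\<close> of the algebra of smooth functions. They are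
  extended by 0 to non-smooth functions, so that each derivation is represented exactly once.
\<close>

type_synonym 'm tangent = "('m \<Rightarrow> real) \<Rightarrow> real"
type_synonym 'm vfield = "'m \<Rightarrow> 'm tangent"

definition tangent_space ::
    "('m::{t2_space,second_countable_topology}, 'e::euclidean_space) atlas \<Rightarrow> 'm \<Rightarrow> 'm tangent set" where
  "tangent_space A p =
     {v. (\<forall>f. f \<notin> smooth_functions A \<longrightarrow> v f = 0) \<and>
         (\<forall>f\<in>smooth_functions A. \<forall>h\<in>smooth_functions A.
            v (f + h) = v f + v h \<and> v (f * h) = f p * v h + h p * v f) \<and>
         (\<forall>f\<in>smooth_functions A. \<forall>c. v (c *\<^sub>R f) = c * v f)}"

definition vapply :: "'m vfield \<Rightarrow> ('m \<Rightarrow> real) \<Rightarrow> 'm \<Rightarrow> real" where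
  "vapply X f = (\<lambda>p. X p f)"

definition vector_fields ::
    "('m::{t2_space,second_countable_topology}, 'e::euclidean_space) atlas \<Rightarrow> 'm vfield set" where
  "vector_fields A =
     {X. (\<forall>p. X p \<in> tangent_space A p) \<and>
         (\<forall>f\<in>smooth_functions A. vapply X f \<in> smooth_functions A)}"

definition fmult :: "('m \<Rightarrow> real) \<Rightarrow> 'm vfield \<Rightarrow> 'm vfield" (infixr "\<odot>" 75) where
  "f \<odot> X = (\<lambda>p. f p *\<^sub>R X p)"

definition lie_bracket :: "'m vfield \<Rightarrow> 'm vfield \<Rightarrow> 'm vfield" where
  "lie_bracket X Y = (\<lambda>p f. X p (vapply Y f) - Y p (vapply X f))"


section \<open>Tensor fields and the Levi-Civita connection\<close>

text \<open>
  A tensor field assigns to each point \<open>p\<close> a multilinear map on the tangent space at \<open>p\<close>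
  (values outside the tangent space are irrelevant); it is smooth if it maps smooth vector fields
  to smooth vector fields or smooth functions.
\<close>

definition one_form_field ::
    "('m::{t2_space,second_countable_topology}, 'e::euclidean_space) atlas
      \<Rightarrow> ('m \<Rightarrow> 'm tangent \<Rightarrow> real) \<Rightarrow> bool" where
  "one_form_field A \<alpha> \<longleftrightarrow>
     (\<forall>p. \<forall>v\<in>tangent_space A p. \<forall>w\<in>tangent_space A p. \<alpha> p (v + w) = \<alpha> p v + \<alpha> p w) \<and>
     (\<forall>p. \<forall>v\<in>tangent_space A p. \<forall>c. \<alpha> p (c *\<^sub>R v) = c * \<alpha> p v) \<and>
     (\<forall>X\<in>vector_fields A. (\<lambda>p. \<alpha> p (X p)) \<in> smooth_functions A)"

definition endomorphism_field ::
    "('m::{t2_space,second_countable_topology}, 'e::euclidean_space) atlas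
      \<Rightarrow> ('m \<Rightarrow> 'm tangent \<Rightarrow> 'm tangent) \<Rightarrow> bool" where
  "endomorphism_field A \<phi> \<longleftrightarrow>
     (\<forall>p. \<forall>v\<in>tangent_space A p. \<phi> p v \<in> tangent_space A p) \<and>
     (\<forall>p. \<forall>v\<in>tangent_space A p. \<forall>w\<in>tangent_space A p. \<phi> p (v + w) = \<phi> p v + \<phi> p w) \<and>
     (\<forall>p. \<forall>v\<in>tangent_space A p. \<forall>c. \<phi> p (c *\<^sub>R v) = c *\<^sub>R \<phi> p v) \<and>
     (\<forall>X\<in>vector_fields A. (\<lambda>p. \<phi> p (X p)) \<in> vector_fields A)"

definition riemannian_metric ::
    "('m::{t2_space,second_countable_topology}, 'e::euclidean_space) atlas
      \<Rightarrow> ('m \<Rightarrow> 'm tangent \<Rightarrow> 'm tangent \<Rightarrow> real) \<Rightarrow> bool" where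
  "riemannian_metric A g \<longleftrightarrow>
     (\<forall>p. \<forall>u\<in>tangent_space A p. \<forall>v\<in>tangent_space A p. \<forall>w\<in>tangent_space A p.
        g p (u + v) w = g p u w + g p v w) \<and>
     (\<forall>p. \<forall>v\<in>tangent_space A p. \<forall>w\<in>tangent_space A p. \<forall>c. g p (c *\<^sub>R v) w = c * g p v w) \<and>
     (\<forall>p. \<forall>v\<in>tangent_space A p. \<forall>w\<in>tangent_space A p. g p v w = g p w v) \<and>
     (\<forall>p. \<forall>v\<in>tangent_space A p. v \<noteq> 0 \<longrightarrow> g p v v > 0) \<and>
     (\<forall>X\<in>vector_fields A. \<forall>Y\<in>vector_fields A. (\<lambda>p. g p (X p) (Y p)) \<in> smooth_functions A)"

text \<open>
  Trace of an endomorphism \<open>f\<close> of a finite-dimensional subspace \<open>V\<close>;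
  the value does not depend on the basis.
\<close>

definition trace_on :: "'v::real_vector set \<Rightarrow> ('v \<Rightarrow> 'v) \<Rightarrow> real" where
  "trace_on V f =
     (let B = (SOME B. independent B \<and> span B = V) in \<Sum>b\<in>B. representation B (f b) b)"

text \<open>
  The axioms below determine \<open>D\<close>, with \<open>D X Y\<close> for $\nabla_X Y$, uniquely on smooth vector fields.
\<close>

definition levi_civita_connection ::
    "('m::{t2_space,second_countable_topology}, 'e::euclidean_space) atlas
      \<Rightarrow> ('m \<Rightarrow> 'm tangent \<Rightarrow> 'm tangent \<Rightarrow> real)
      \<Rightarrow> ('m vfield \<Rightarrow> 'm vfield \<Rightarrow> 'm vfield) \<Rightarrow> bool" where
  "levi_civita_connection A g D \<longleftrightarrow>
     (\<forall>X\<in>vector_fields A. \<forall>Y\<in>vector_fields A. D X Y \<in> vector_fields A) \<and>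
     (\<forall>X\<in>vector_fields A. \<forall>Y\<in>vector_fields A. \<forall>Z\<in>vector_fields A.
        D (X + Y) Z = D X Z + D Y Z \<and> D X (Y + Z) = D X Y + D X Z) \<and>
     (\<forall>f\<in>smooth_functions A. \<forall>X\<in>vector_fields A. \<forall>Y\<in>vector_fields A.
        D (f \<odot> X) Y = f \<odot> D X Y \<and> D X (f \<odot> Y) = vapply X f \<odot> Y + f \<odot> D X Y) \<and>
     (\<forall>X\<in>vector_fields A. \<forall>Y\<in>vector_fields A. D X Y - D Y X = lie_bracket X Y) \<and>
     (\<forall>X\<in>vector_fields A. \<forall>Y\<in>vector_fields A. \<forall>Z\<in>vector_fields A.
        vapply X (\<lambda>p. g p (Y p) (Z p)) =
          (\<lambda>p. g p (D X Y p) (Z p)) + (\<lambda>p. g p (Y p) (D X Z p)))"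


section \<open>Almost paracontact almost paracomplex Riemannian manifolds\<close>

record ('m, 'e) apapr_structure =
  atlas :: "('m, 'e) atlas"
  phi :: "'m \<Rightarrow> 'm tangent \<Rightarrow> 'm tangent"
  xi :: "'m vfield"
  eta :: "'m \<Rightarrow> 'm tangent \<Rightarrow> real"
  metric :: "'m \<Rightarrow> 'm tangent \<Rightarrow> 'm tangent \<Rightarrow> real"

definition apapr_manifold ::
    "nat \<Rightarrow> ('m::{t2_space,second_countable_topology}, 'e::euclidean_space) apapr_structure \<Rightarrow> bool" where
  "apapr_manifold n M \<longleftrightarrow>
     DIM('e) = 2 * n + 1 \<and> smooth_atlas (atlas M) \<and>
     endomorphism_field (atlas M) (phi M) \<and> xi M \<in> vector_fields (atlas M) \<and>
     one_form_field (atlas M) (eta M) \<and> riemannian_metric (atlas M) (metric M) \<and>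
     (\<forall>p. phi M p (xi M p) = 0 \<and> eta M p (xi M p) = 1 \<and>
          trace_on (tangent_space (atlas M) p) (phi M p) = 0) \<and>
     (\<forall>p. \<forall>v\<in>tangent_space (atlas M) p.
          phi M p (phi M p v) = v - eta M p v *\<^sub>R xi M p \<and>
          eta M p (phi M p v) = 0 \<and>
          metric M p v (xi M p) = eta M p v) \<and>
     (\<forall>p. \<forall>v\<in>tangent_space (atlas M) p. \<forall>w\<in>tangent_space (atlas M) p.
          metric M p (phi M p v) (phi M p w) = metric M p v w - eta M p v * eta M p w)"

definition vphi :: "('m, 'e) apapr_structure \<Rightarrow> 'm vfield \<Rightarrow> 'm vfield" where
  "vphi M x = (\<lambda>p. phi M p (x p))"

definition veta :: "('m, 'e) apapr_structure \<Rightarrow> 'm vfield \<Rightarrow> 'm \<Rightarrow> real" where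
  "veta M x = (\<lambda>p. eta M p (x p))"

definition vg :: "('m, 'e) apapr_structure \<Rightarrow> 'm vfield \<Rightarrow> 'm vfield \<Rightarrow> 'm \<Rightarrow> real" where
  "vg M x y = (\<lambda>p. metric M p (x p) (y p))"

text \<open>
  From here on \<open>D\<close> stands for the Levi-Civita connection. Tensors derived from it are given as
  maps on smooth vector fields.
\<close>

type_synonym 'm connection = "'m vfield \<Rightarrow> 'm vfield \<Rightarrow> 'm vfield"

definition fundamental_F ::
    "('m, 'e) apapr_structure \<Rightarrow> 'm connection
      \<Rightarrow> 'm vfield \<Rightarrow> 'm vfield \<Rightarrow> 'm vfield \<Rightarrow> 'm \<Rightarrow> real" where
  "fundamental_F M D x y z = vg M (D x (vphi M y) - vphi M (D x y)) z"

definition nabla_eta ::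
    "('m, 'e) apapr_structure \<Rightarrow> 'm connection \<Rightarrow> 'm vfield \<Rightarrow> 'm vfield \<Rightarrow> 'm \<Rightarrow> real" where
  "nabla_eta M D x y = vapply x (veta M y) - veta M (D x y)"

definition lie_xi_g ::
    "('m, 'e) apapr_structure \<Rightarrow> 'm connection \<Rightarrow> 'm vfield \<Rightarrow> 'm vfield \<Rightarrow> 'm \<Rightarrow> real" where
  "lie_xi_g M D x y = nabla_eta M D x y + nabla_eta M D y x"

definition sym_bracket :: "'m connection \<Rightarrow> 'm vfield \<Rightarrow> 'm vfield \<Rightarrow> 'm vfield" where
  "sym_bracket D x y = D x y + D y x"

definition phi_sym_bracket ::
    "('m, 'e) apapr_structure \<Rightarrow> 'm connection \<Rightarrow> 'm vfield \<Rightarrow> 'm vfield \<Rightarrow> 'm vfield" where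
  "phi_sym_bracket M D x y =
     sym_bracket D (vphi M x) (vphi M y) + vphi M (vphi M (sym_bracket D x y))
     - vphi M (sym_bracket D (vphi M x) y) - vphi M (sym_bracket D x (vphi M y))"


subsection \<open>Associated Nijenhuis tensors\<close>

definition Nhat1 ::
    "('m, 'e) apapr_structure \<Rightarrow> 'm connection \<Rightarrow> 'm vfield \<Rightarrow> 'm vfield \<Rightarrow> 'm vfield" where
  "Nhat1 M D x y = phi_sym_bracket M D x y - lie_xi_g M D x y \<odot> xi M"

definition Nhat2 ::
    "('m, 'e) apapr_structure \<Rightarrow> 'm connection \<Rightarrow> 'm vfield \<Rightarrow> 'm vfield \<Rightarrow> 'm \<Rightarrow> real" where
  "Nhat2 M D x y = lie_xi_g M D (vphi M x) y + lie_xi_g M D x (vphi M y)"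

definition Nhat3 :: "('m, 'e) apapr_structure \<Rightarrow> 'm connection \<Rightarrow> 'm vfield \<Rightarrow> 'm vfield" where
  "Nhat3 M D x = sym_bracket D (vphi M x) (xi M) - vphi M (sym_bracket D x (xi M))"

definition Nhat4 :: "('m, 'e) apapr_structure \<Rightarrow> 'm connection \<Rightarrow> 'm vfield \<Rightarrow> 'm \<Rightarrow> real" where
  "Nhat4 M D x = lie_xi_g M D x (xi M)"

definition Nhat1_cov ::
    "('m, 'e) apapr_structure \<Rightarrow> 'm connection
      \<Rightarrow> 'm vfield \<Rightarrow> 'm vfield \<Rightarrow> 'm vfield \<Rightarrow> 'm \<Rightarrow> real" where
  "Nhat1_cov M D x y z = vg M (Nhat1 M D x y) z"

definition Nhat3_cov ::
    "('m, 'e) apapr_structure \<Rightarrow> 'm connection \<Rightarrow> 'm vfield \<Rightarrow> 'm vfield \<Rightarrow> 'm \<Rightarrow> real" where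
  "Nhat3_cov M D x y = vg M (Nhat3 M D x) y"


subsection \<open>Lee forms\<close>

text \<open>
  Since \<open>F\<close> takes vector fields as arguments, an orthonormal basis \<open>e\<^sub>0, \<dots>, e\<^bsub>2n-1\<^esub>\<close> of $\ker \eta$
  at \<open>p\<close> is given by vector fields \<open>E i\<close> with value \<open>e\<^sub>i\<close> at \<open>p\<close>. Such fields exist, and as \<open>F\<close> is a
  tensor, the traces below depend neither on the choice of the basis nor on that of the fields.
\<close>

definition horizontal_frame_at ::
    "nat \<Rightarrow> ('m::{t2_space,second_countable_topology}, 'e::euclidean_space) apapr_structure
      \<Rightarrow> 'm \<Rightarrow> (nat \<Rightarrow> 'm vfield) \<Rightarrow> bool" where
  "horizontal_frame_at n M p E \<longleftrightarrow>
     (\<forall>i<2*n. E i \<in> vector_fields (atlas M)) \<and>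
     (\<forall>i<2*n. \<forall>j<2*n. metric M p (E i p) (E j p) = (if i = j then 1 else 0)) \<and>
     span ((\<lambda>i. E i p) ` {..<2*n}) = {v \<in> tangent_space (atlas M) p. eta M p v = 0}"

definition theta ::
    "nat \<Rightarrow> ('m::{t2_space,second_countable_topology}, 'e::euclidean_space) apapr_structure
      \<Rightarrow> 'm connection \<Rightarrow> 'm vfield \<Rightarrow> 'm \<Rightarrow> real" where
  "theta n M D z = (\<lambda>p.
     let E = (SOME E. horizontal_frame_at n M p E)
     in \<Sum>i<2*n. fundamental_F M D (E i) (E i) z p)"

definition theta_star ::
    "nat \<Rightarrow> ('m::{t2_space,second_countable_topology}, 'e::euclidean_space) apapr_structure
      \<Rightarrow> 'm connection \<Rightarrow> 'm vfield \<Rightarrow> 'm \<Rightarrow> real" where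
  "theta_star n M D z = (\<lambda>p.
     let E = (SOME E. horizontal_frame_at n M p E)
     in \<Sum>i<2*n. fundamental_F M D (E i) (vphi M (E i)) z p)"

definition omega ::
    "('m, 'e) apapr_structure \<Rightarrow> 'm connection \<Rightarrow> 'm vfield \<Rightarrow> 'm \<Rightarrow> real" where
  "omega M D z = fundamental_F M D (xi M) (xi M) z"


subsection \<open>Components of the fundamental tensor and basic classes\<close>

text \<open>The (0,3)-tensor $[S]$ of a (0,2)-tensor $S$.\<close>

definition sq_ext ::
    "('m, 'e) apapr_structure \<Rightarrow> ('m vfield \<Rightarrow> 'm vfield \<Rightarrow> 'm \<Rightarrow> real)
      \<Rightarrow> 'm vfield \<Rightarrow> 'm vfield \<Rightarrow> 'm vfield \<Rightarrow> 'm \<Rightarrow> real" where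
  "sq_ext M S x y z = S x y * veta M z + S x z * veta M y"

definition b_tensor ::
    "('m, 'e) apapr_structure \<Rightarrow> 'm connection \<Rightarrow> 'm vfield \<Rightarrow> 'm vfield \<Rightarrow> 'm \<Rightarrow> real" where
  "b_tensor M D x y = fundamental_F M D (vphi M (vphi M x)) (vphi M (vphi M y)) (xi M)"

definition c_tensor ::
    "('m, 'e) apapr_structure \<Rightarrow> 'm connection \<Rightarrow> 'm vfield \<Rightarrow> 'm vfield \<Rightarrow> 'm \<Rightarrow> real" where
  "c_tensor M D x y = fundamental_F M D (vphi M x) (vphi M y) (xi M)"

definition F_comp ::
    "nat \<Rightarrow> ('m::{t2_space,second_countable_topology}, 'e::euclidean_space) apapr_structure
      \<Rightarrow> 'm connection \<Rightarrow> nat \<Rightarrow> 'm vfield \<Rightarrow> 'm vfield \<Rightarrow> 'm vfield \<Rightarrow> 'm \<Rightarrow> real" where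
  "F_comp n M D i x y z =
    (let \<phi> = vphi M; \<phi>2 = (\<lambda>x. vphi M (vphi M x)); \<xi> = xi M; \<eta> = veta M; g = vg M;
         F = fundamental_F M D; \<theta> = theta n M D; \<theta>s = theta_star n M D; \<omega> = omega M D;
         b = b_tensor M D; c = c_tensor M D;
         F1 = (1 / (2 * real n)) *\<^sub>R
                (g (\<phi> x) (\<phi> y) * \<theta> (\<phi>2 z) + g (\<phi> x) (\<phi> z) * \<theta> (\<phi>2 y)
                 - g x (\<phi> y) * \<theta> (\<phi> z) - g x (\<phi> z) * \<theta> (\<phi> y));
         F4 = (1 / (2 * real n)) *\<^sub>R (\<theta> \<xi> * sq_ext M (\<lambda>x y. g (\<phi> x) (\<phi> y)) x y z);
         F5 = (1 / (2 * real n)) *\<^sub>R (\<theta>s \<xi> * sq_ext M (\<lambda>x y. g x (\<phi> y)) x y z)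
     in
       if i = 1 then F1
       else if i = 2 then
         (1/4) *\<^sub>R (2 *\<^sub>R F (\<phi>2 x) (\<phi>2 y) (\<phi>2 z)
                   + F (\<phi>2 y) (\<phi>2 z) (\<phi>2 x) + F (\<phi>2 z) (\<phi>2 x) (\<phi>2 y)
                   - F (\<phi> y) (\<phi> z) (\<phi>2 x) - F (\<phi> z) (\<phi> y) (\<phi>2 x)) - F1
       else if i = 3 then
         (1/4) *\<^sub>R (2 *\<^sub>R F (\<phi>2 x) (\<phi>2 y) (\<phi>2 z)
                   - F (\<phi>2 y) (\<phi>2 z) (\<phi>2 x) - F (\<phi>2 z) (\<phi>2 x) (\<phi>2 y)
                   + F (\<phi> y) (\<phi> z) (\<phi>2 x) + F (\<phi> z) (\<phi> y) (\<phi>2 x))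
       else if i = 4 then F4
       else if i = 5 then F5
       else if i = 6 then
         (1/4) *\<^sub>R sq_ext M (\<lambda>x y. b x y + b y x + c x y + c y x) x y z - F4 - F5
       else if i = 7 then
         (1/4) *\<^sub>R sq_ext M (\<lambda>x y. b x y - b y x + c x y - c y x) x y z
       else if i = 8 then
         (1/4) *\<^sub>R sq_ext M (\<lambda>x y. b x y + b y x - c x y - c y x) x y z
       else if i = 9 then
         (1/4) *\<^sub>R sq_ext M (\<lambda>x y. b x y - b y x - c x y + c y x) x y z
       else if i = 10 then \<eta> x * F \<xi> (\<phi>2 y) (\<phi>2 z)
       else if i = 11 then \<eta> x * (\<eta> y * \<omega> z + \<eta> z * \<omega> y)
       else undefined)"

definition in_basic_class ::
    "nat \<Rightarrow> ('m::{t2_space,second_countable_topology}, 'e::euclidean_space) apapr_structure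
      \<Rightarrow> 'm connection \<Rightarrow> nat \<Rightarrow> bool" where
  "in_basic_class n M D i \<longleftrightarrow>
     i \<in> {1..11} \<and>
     (\<forall>x\<in>vector_fields (atlas M). \<forall>y\<in>vector_fields (atlas M). \<forall>z\<in>vector_fields (atlas M).
        fundamental_F M D x y z = F_comp n M D i x y z)"

end

theory Submission
  imports Defs
begin

text \<open>
  All four associated Nijenhuis tensors are linear expressions in the fundamental tensor \<open>F\<close>, and the
  equation $F = F_i$ then leaves a finite computation in each class.

  The translation into \<open>F\<close> rests on $(\nabla_x\eta)y = -F(x,\phi y,\xi)$ (\<open>nabla_eta_F\<close>), which comes
  from differentiating $\phi^2 = I - \eta\otimes\xi$. It gives
  \<^item> $\widehat N^{(1)}(x,y,z) = F(\phi x,y,z) + F(\phi y,x,z) - F(x,y,\phi z) - F(y,x,\phi z)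
      + \{F(x,\phi y,\xi) + F(y,\phi x,\xi)\}\eta(z)$,
  \<^item> $\widehat N^{(2)}(x,y) = -F(\phi x,\phi y,\xi) - F(\phi y,\phi x,\xi) - F(x,\phi^2y,\xi) - F(y,\phi^2x,\xi)$,
  \<^item> $\widehat N^{(3)}(x,z) = F(\xi,x,z) + F(x,\xi,z) - F(\phi x,\phi z,\xi)$ and
    $\widehat N^{(4)}(x) = -\omega(\phi x)$.

  The classes fall into three groups. In the first three \<open>F\<close> vanishes as soon as one argument is
  $\xi$, so that only $\widehat N^{(1)}$ survives; it is the symmetrization in $x,y$ of
  $F(\phi x,y,z) - F(x,y,\phi z)$, and this difference is computed for $F_1$ in \<open>F_comp_1_shift\<close> and
  for $F_1 + F_2$ in \<open>F12_shift\<close>. In the classes 4 to 9 one has $F = [S]$ with a horizontal tensor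
  \<open>S\<close> that $\phi$ preserves or reverses, $S(\phi x,\phi y) = \pm S(x,y)$; the sign and the symmetry of
  \<open>S\<close> determine everything (\<open>Nhat_vertical\<close>). In the classes 10 and 11 the first argument
  of \<open>F\<close> contributes only through $\eta$, and the formulas can be read off.
\<close>

section \<open>Linear structure of functions, tangent vectors and vector fields\<close>

text \<open>
  The derivatives at the points of an open set see only the values there.
\<close>

lemma Ck_on_cong:
  assumes "open S" "\<And>x. x \<in> S \<Longrightarrow> f x = g x" "Ck_on k S f"
  shows "Ck_on k S g"
  using assms(2,3)
proof (induction k arbitrary: f g)
  case 0
  then show ?case by (simp cong: continuous_on_cong)
next
  case (Suc k)
  have der: "(g has_derivative frechet_derivative f (at x)) (at x)" if "x \<in> S" for x
  proof -
    have "(f has_derivative frechet_derivative f (at x)) (at x)"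
      using Suc.prems(2) that by (simp add: frechet_derivative_works)
    then show ?thesis
      using has_derivative_transform_within_open[OF _ assms(1) that] Suc.prems(1) by blast
  qed
  have eq: "frechet_derivative f (at x) = frechet_derivative g (at x)" if "x \<in> S" for x
    using frechet_derivative_at[OF der[OF that]] .
  have "g differentiable (at x)" if "x \<in> S" for x
    using der[OF that] by (auto simp: differentiable_def)
  moreover have "Ck_on k S (\<lambda>x. frechet_derivative g (at x) v)" for v
    using Suc.IH[of "\<lambda>x. frechet_derivative f (at x) v" "\<lambda>x. frechet_derivative g (at x) v"]
      Suc.prems(2) eq by simp
  ultimately show ?case by simp
qed

lemma Ck_on_lincomb:
  assumes "open S" "Ck_on k S f" "Ck_on k S g"
  shows "Ck_on k S (\<lambda>x. a *\<^sub>R f x + b *\<^sub>R g x)"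
  using assms(2,3)
proof (induction k arbitrary: f g)
  case 0
  then show ?case by (auto intro!: continuous_intros)
next
  case (Suc k)
  let ?h = "\<lambda>x. a *\<^sub>R f x + b *\<^sub>R g x"
  let ?h' = "\<lambda>x v. a *\<^sub>R frechet_derivative f (at x) v + b *\<^sub>R frechet_derivative g (at x) v"
  have der: "(?h has_derivative ?h' x) (at x)" if "x \<in> S" for x
    using Suc.prems that
    by (auto intro!: derivative_eq_intros simp: frechet_derivative_works[symmetric])
  have "?h differentiable (at x)" if "x \<in> S" for x
    using der[OF that] by (auto simp: differentiable_def)
  moreover have "Ck_on k S (\<lambda>x. frechet_derivative ?h (at x) v)" for v
  proof (rule Ck_on_cong[OF assms(1)])
    show "Ck_on k S (\<lambda>x. ?h' x v)"
      using Suc by simp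
    show "?h' x v = frechet_derivative ?h (at x) v" if "x \<in> S" for x
      using frechet_derivative_at[OF der[OF that]] by metis
  qed
  ultimately show ?case by simp
qed

lemma subspace_smooth_functions:
  assumes "smooth_atlas A"
  shows "subspace (smooth_functions A)"
proof -
  have op: "open (h ` U)" if "(U, h) \<in> A" for U h
    using assms that by (auto simp: smooth_atlas_def)
  have lin: "a *\<^sub>R f + b *\<^sub>R g \<in> smooth_functions A"
    if "f \<in> smooth_functions A" "g \<in> smooth_functions A" for a b and f g :: "'a \<Rightarrow> real"
  proof -
    have "smooth_on (h ` U) ((a *\<^sub>R f + b *\<^sub>R g) \<circ> inv_into U h)" if "(U, h) \<in> A" for U h
    proof -
      have "smooth_on (h ` U) (f \<circ> inv_into U h)" "smooth_on (h ` U) (g \<circ> inv_into U h)"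
        using that \<open>f \<in> _\<close> \<open>g \<in> _\<close> by (auto simp: smooth_functions_def)
      then show ?thesis
        using Ck_on_lincomb[OF op[OF that], of _ "f \<circ> inv_into U h" "g \<circ> inv_into U h" a b]
        by (simp add: smooth_on_def o_def)
    qed
    then show ?thesis by (auto simp: smooth_functions_def)
  qed
  have zero: "Ck_on k S (\<lambda>_. 0)" for k and S :: "'b set"
    by (induction k) simp_all
  show ?thesis
  proof (rule subspaceI)
    show "(0 :: 'a \<Rightarrow> real) \<in> smooth_functions A"
      by (auto simp: smooth_functions_def smooth_on_def o_def zero)
    show "f + g \<in> smooth_functions A" if "f \<in> smooth_functions A" "g \<in> smooth_functions A" for f g
      using lin[OF that, of 1 1] by simp
    show "c *\<^sub>R f \<in> smooth_functions A" if "f \<in> smooth_functions A" for c f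
      using lin[OF that that, of c 0] by simp
  qed
qed

lemma subspace_tangent_space: "subspace (tangent_space A p)"
  by (rule subspaceI) (auto simp: tangent_space_def algebra_simps)

lemma subspace_vector_fields:
  assumes "smooth_atlas A"
  shows "subspace (vector_fields A)"
proof (rule subspaceI)
  note sf = subspace_smooth_functions[OF assms] and ts = subspace_tangent_space
  have zero: "vapply 0 f = 0" for f :: "'a \<Rightarrow> real"
    by (simp add: vapply_def fun_eq_iff)
  have add: "vapply (X + Y) f = vapply X f + vapply Y f" for X Y and f :: "'a \<Rightarrow> real"
    by (simp add: vapply_def fun_eq_iff)
  have scale: "vapply (c *\<^sub>R X) f = c *\<^sub>R vapply X f" for c X and f :: "'a \<Rightarrow> real"
    by (simp add: vapply_def fun_eq_iff)
  show "0 \<in> vector_fields A"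
    by (simp add: vector_fields_def zero subspace_0[OF sf] subspace_0[OF ts])
  show "X + Y \<in> vector_fields A" if "X \<in> vector_fields A" "Y \<in> vector_fields A" for X Y
    using that by (simp add: vector_fields_def add subspace_add[OF sf] subspace_add[OF ts])
  show "c *\<^sub>R X \<in> vector_fields A" if "X \<in> vector_fields A" for c X
    using that by (simp add: vector_fields_def scale subspace_scale[OF sf] subspace_scale[OF ts])
qed

section \<open>Algebra of the structure tensors\<close>

locale apapr_levi_civita =
  fixes n :: nat
    and M :: "('m::{t2_space,second_countable_topology}, 'e::euclidean_space) apapr_structure"
    and D :: "'m vfield \<Rightarrow> 'm vfield \<Rightarrow> 'm vfield"
  assumes manifold: "apapr_manifold n M"
    and connection: "levi_civita_connection (atlas M) (metric M) D"
begin

abbreviation "VF \<equiv> vector_fields (atlas M)"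
abbreviation "SF \<equiv> smooth_functions (atlas M)"
abbreviation "T \<equiv> tangent_space (atlas M)"
abbreviation \<phi> where "\<phi> \<equiv> vphi M"
abbreviation \<xi> where "\<xi> \<equiv> xi M"
abbreviation \<eta> where "\<eta> \<equiv> veta M"
abbreviation g where "g \<equiv> vg M"
abbreviation F where "F \<equiv> fundamental_F M D"

lemma
  endo: "endomorphism_field (atlas M) (phi M)" and
  xi_VF [simp]: "\<xi> \<in> VF" and
  one_form: "one_form_field (atlas M) (eta M)" and
  riem: "riemannian_metric (atlas M) (metric M)"
  using manifold by (auto simp: apapr_manifold_def)

lemma subspace_VF: "subspace VF"
  using manifold by (auto simp: apapr_manifold_def intro: subspace_vector_fields)

lemma
  zero_VF [simp]: "0 \<in> VF" and
  add_VF [simp]: "x \<in> VF \<Longrightarrow> y \<in> VF \<Longrightarrow> x + y \<in> VF" and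
  diff_VF [simp]: "x \<in> VF \<Longrightarrow> y \<in> VF \<Longrightarrow> x - y \<in> VF"
  using subspace_0[OF subspace_VF] subspace_add[OF subspace_VF] subspace_diff[OF subspace_VF]
  by auto

lemma
  phi_VF [simp]: "x \<in> VF \<Longrightarrow> \<phi> x \<in> VF" and
  eta_SF [simp]: "x \<in> VF \<Longrightarrow> \<eta> x \<in> SF" and
  g_SF [simp]: "x \<in> VF \<Longrightarrow> y \<in> VF \<Longrightarrow> g x y \<in> SF"
  using endo one_form riem
  by (auto simp: endomorphism_field_def one_form_field_def riemannian_metric_def
      vphi_def veta_def vg_def)

lemma
  VF_T [simp]: "x \<in> VF \<Longrightarrow> x p \<in> T p" and
  T_add [simp]: "v \<in> T p \<Longrightarrow> w \<in> T p \<Longrightarrow> v + w \<in> T p" and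
  T_diff [simp]: "v \<in> T p \<Longrightarrow> w \<in> T p \<Longrightarrow> v - w \<in> T p" and
  T_scale [simp]: "v \<in> T p \<Longrightarrow> c *\<^sub>R v \<in> T p"
  using subspace_add[OF subspace_tangent_space] subspace_diff[OF subspace_tangent_space]
    subspace_scale[OF subspace_tangent_space]
  by (auto simp: vector_fields_def)

lemma
  metric_add: "u \<in> T p \<Longrightarrow> v \<in> T p \<Longrightarrow> w \<in> T p \<Longrightarrow>
    metric M p (u + v) w = metric M p u w + metric M p v w" and
  metric_scale: "v \<in> T p \<Longrightarrow> w \<in> T p \<Longrightarrow> metric M p (c *\<^sub>R v) w = c * metric M p v w" and
  metric_sym: "v \<in> T p \<Longrightarrow> w \<in> T p \<Longrightarrow> metric M p v w = metric M p w v" and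
  metric_pos: "v \<in> T p \<Longrightarrow> v \<noteq> 0 \<Longrightarrow> metric M p v v > 0"
  using riem unfolding riemannian_metric_def by blast+

lemma metric_diff:
  assumes "u \<in> T p" "v \<in> T p" "w \<in> T p"
  shows "metric M p (u - v) w = metric M p u w - metric M p v w"
  using metric_add[of "u - v" p v w] assms by simp

lemma g_commute: "x \<in> VF \<Longrightarrow> y \<in> VF \<Longrightarrow> g x y = g y x"
  by (auto simp: vg_def fun_eq_iff intro: metric_sym)

lemma
  g_add: "x \<in> VF \<Longrightarrow> y \<in> VF \<Longrightarrow> z \<in> VF \<Longrightarrow> g (x + y) z = g x z + g y z" and
  g_diff: "x \<in> VF \<Longrightarrow> y \<in> VF \<Longrightarrow> z \<in> VF \<Longrightarrow> g (x - y) z = g x z - g y z"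
  by (auto simp: vg_def fun_eq_iff metric_add metric_diff)

lemma g_diff_right: "x \<in> VF \<Longrightarrow> y \<in> VF \<Longrightarrow> z \<in> VF \<Longrightarrow> g z (x - y) = g z x - g z y"
  using g_commute g_diff diff_VF by metis

lemma g_diff_fmult:
  "x \<in> VF \<Longrightarrow> y \<in> VF \<Longrightarrow> z \<in> VF \<Longrightarrow> g (x - f \<odot> y) z = g x z - f * g y z"
  by (auto simp: vg_def fmult_def fun_eq_iff metric_diff metric_scale)

lemma g_zero: "z \<in> VF \<Longrightarrow> g 0 z = 0" "z \<in> VF \<Longrightarrow> g z 0 = 0"
  using g_diff[of z z z] g_diff_right[of z z z] by simp_all

lemma g_minus: "x \<in> VF \<Longrightarrow> z \<in> VF \<Longrightarrow> g (- x) z = - g x z"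
  using g_diff[of 0 x z] by (simp add: g_zero)

lemma g_xi: "x \<in> VF \<Longrightarrow> g x \<xi> = \<eta> x"
  using manifold by (auto simp: apapr_manifold_def vg_def veta_def fun_eq_iff)

lemma phi_add: "x \<in> VF \<Longrightarrow> y \<in> VF \<Longrightarrow> \<phi> (x + y) = \<phi> x + \<phi> y"
  using endo by (auto simp: endomorphism_field_def vphi_def fun_eq_iff)

lemma phi_diff: "x \<in> VF \<Longrightarrow> y \<in> VF \<Longrightarrow> \<phi> (x - y) = \<phi> x - \<phi> y"
  using phi_add[of "x - y" y] by simp

lemma phi_diff_fmult:
  assumes "x \<in> VF" "y \<in> VF" shows "\<phi> (x - f \<odot> y) = \<phi> x - f \<odot> \<phi> y"
proof -
  have "phi M p (x p - f p *\<^sub>R y p) = phi M p (x p) - f p *\<^sub>R phi M p (y p)" for p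
  proof -
    have T: "x p \<in> T p" "y p \<in> T p" "x p - f p *\<^sub>R y p \<in> T p" "f p *\<^sub>R y p \<in> T p"
      using assms by simp_all
    have "phi M p ((x p - f p *\<^sub>R y p) + f p *\<^sub>R y p) = phi M p (x p - f p *\<^sub>R y p) + f p *\<^sub>R phi M p (y p)"
      using endo T unfolding endomorphism_field_def by metis
    then show ?thesis by (simp add: algebra_simps)
  qed
  then show ?thesis by (simp add: vphi_def fmult_def fun_eq_iff)
qed

lemma fmult_zero [simp]: "f \<odot> 0 = 0" "0 \<odot> x = 0"
  by (simp_all add: fmult_def fun_eq_iff)

lemma phi_xi [simp]: "\<phi> \<xi> = 0"
  using manifold by (simp add: apapr_manifold_def vphi_def fun_eq_iff)

lemma phi_zero [simp]: "\<phi> 0 = 0"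
  using phi_diff[of \<xi> \<xi>] by simp

lemma eta_xi [simp]: "\<eta> \<xi> = 1"
  using manifold by (simp add: apapr_manifold_def veta_def fun_eq_iff)

lemma eta_phi [simp]: "x \<in> VF \<Longrightarrow> \<eta> (\<phi> x) = 0"
  using manifold by (simp add: apapr_manifold_def veta_def vphi_def fun_eq_iff)

lemma phi_phi: "x \<in> VF \<Longrightarrow> \<phi> (\<phi> x) = x - \<eta> x \<odot> \<xi>"
  using manifold by (simp add: apapr_manifold_def veta_def vphi_def fmult_def fun_eq_iff)

lemma phi_phi_phi [simp]: "x \<in> VF \<Longrightarrow> \<phi> (\<phi> (\<phi> x)) = \<phi> x"
  by (simp add: phi_phi[of "\<phi> x"])

text \<open>
  This field is $x - \phi^2x$, and $\phi$ preserves smoothness.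
\<close>

lemma eta_fmult_xi_VF [simp]:
  assumes "x \<in> VF" shows "\<eta> x \<odot> \<xi> \<in> VF"
proof -
  have "\<eta> x \<odot> \<xi> = x - \<phi> (\<phi> x)" using phi_phi[OF assms] by simp
  then show ?thesis using assms by simp
qed

lemma g_phi_phi: "x \<in> VF \<Longrightarrow> y \<in> VF \<Longrightarrow> g (\<phi> x) (\<phi> y) = g x y - \<eta> x * \<eta> y"
  using manifold by (simp add: apapr_manifold_def vg_def veta_def vphi_def fun_eq_iff)

text \<open>
  Compatibility for the pair $\phi x, y$ reads $g(\phi^2x,\phi y) = g(\phi x,y)$, because
  $\eta\circ\phi = 0$; the left side is $g(x,\phi y)$ because $\phi y\perp\xi$.
\<close>

lemma g_phi_left:
  assumes "x \<in> VF" "y \<in> VF" shows "g (\<phi> x) y = g x (\<phi> y)"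
proof -
  have "g (\<phi> x) y = g (\<phi> (\<phi> x)) (\<phi> y)"
    using assms by (simp add: g_phi_phi[of "\<phi> x"])
  also have "\<dots> = g x (\<phi> y) - \<eta> x * g (\<phi> y) \<xi>"
    using assms by (simp add: phi_phi[of x] g_diff_fmult g_commute[of \<xi>])
  finally show ?thesis using assms by (simp add: g_xi)
qed

text \<open>
  Nondegeneracy of \<open>g\<close>, tested on vector fields instead of tangent vectors. For an
  arbitrary function \<open>f\<close> the field \<open>x - f \<odot> y\<close> may fail to be smooth and is then no test field
  itself; pointwise, however, it is a combination of the test fields \<open>x\<close> and \<open>y\<close>.
\<close>

lemma vector_field_eq_0I:
  assumes "x \<in> VF" "y \<in> VF" "\<And>z. z \<in> VF \<Longrightarrow> g (x - f \<odot> y) z = 0"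
  shows "x - f \<odot> y = 0"
proof (rule ext)
  fix p
  define v where "v = (x - f \<odot> y) p"
  have v: "v = x p - f p *\<^sub>R y p"
    by (simp add: v_def fmult_def)
  have T: "x p \<in> T p" "y p \<in> T p" "f p *\<^sub>R y p \<in> T p" "v \<in> T p"
    using assms(1,2) by (simp_all add: v)
  have "metric M p v (w p) = 0" if "w \<in> VF" for w
    using fun_cong[OF assms(3)[OF that], of p] by (simp add: vg_def v_def)
  then have orth: "metric M p (x p) v = 0" "metric M p (y p) v = 0"
    using assms(1,2) metric_sym[OF T(1,4)] metric_sym[OF T(2,4)] by auto
  have "metric M p v v = metric M p (x p) v - f p * metric M p (y p) v"
    using metric_diff[OF T(1,3,4)] metric_scale[OF T(2,4)] by (simp only: v[symmetric])
  then have "metric M p v v = 0"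
    by (simp add: orth)
  then have "v = 0"
    using metric_pos[OF T(4)] by (metis less_irrefl)
  then show "(x - f \<odot> y) p = 0 p"
    by (simp add: v_def)
qed

section \<open>Covariant derivatives\<close>

lemma
  D_VF [simp]: "x \<in> VF \<Longrightarrow> y \<in> VF \<Longrightarrow> D x y \<in> VF" and
  D_add_left: "x \<in> VF \<Longrightarrow> y \<in> VF \<Longrightarrow> z \<in> VF \<Longrightarrow> D (x + y) z = D x z + D y z" and
  D_add_right: "x \<in> VF \<Longrightarrow> y \<in> VF \<Longrightarrow> z \<in> VF \<Longrightarrow> D x (y + z) = D x y + D x z" and
  D_fmult_left: "f \<in> SF \<Longrightarrow> x \<in> VF \<Longrightarrow> y \<in> VF \<Longrightarrow> D (f \<odot> x) y = f \<odot> D x y" and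
  D_fmult_right: "f \<in> SF \<Longrightarrow> x \<in> VF \<Longrightarrow> y \<in> VF \<Longrightarrow> D x (f \<odot> y) = vapply x f \<odot> y + f \<odot> D x y" and
  D_metric: "x \<in> VF \<Longrightarrow> y \<in> VF \<Longrightarrow> z \<in> VF \<Longrightarrow> vapply x (g y z) = g (D x y) z + g y (D x z)"
  using connection unfolding levi_civita_connection_def vg_def by blast+

lemma D_diff_left: "x \<in> VF \<Longrightarrow> y \<in> VF \<Longrightarrow> z \<in> VF \<Longrightarrow> D (x - y) z = D x z - D y z"
  using D_add_left[of "x - y" y z] by simp

lemma D_diff_right: "x \<in> VF \<Longrightarrow> y \<in> VF \<Longrightarrow> z \<in> VF \<Longrightarrow> D x (y - z) = D x y - D x z"
  using D_add_right[of x "y - z" z] by simp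

lemma D_zero [simp]: "x \<in> VF \<Longrightarrow> D x 0 = 0" "x \<in> VF \<Longrightarrow> D 0 x = 0"
  using D_diff_right[of x x x] D_diff_left[of x x x] by simp_all

lemma D_phi_phi_left:
  "x \<in> VF \<Longrightarrow> y \<in> VF \<Longrightarrow> D (\<phi> (\<phi> x)) y = D x y - \<eta> x \<odot> D \<xi> y"
  by (simp add: phi_phi[of x] D_diff_left D_fmult_left)

lemma D_phi_phi_right:
  "x \<in> VF \<Longrightarrow> y \<in> VF \<Longrightarrow>
    D x (\<phi> (\<phi> y)) = D x y - \<eta> y \<odot> D x \<xi> - vapply x (\<eta> y) \<odot> \<xi>"
  by (simp add: phi_phi[of y] D_diff_right D_fmult_right)

text \<open>
  The function 1 is smooth because it is \<open>g \<xi> \<xi>\<close>.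
\<close>

lemma vapply_one: "x \<in> VF \<Longrightarrow> vapply x 1 = 0"
proof -
  assume "x \<in> VF"
  have one: "1 \<in> SF" using g_SF[of \<xi> \<xi>] by (simp add: g_xi)
  have "x p 1 = 0" for p
  proof -
    have "x p (1 * 1) = 1 p * x p 1 + 1 p * x p 1"
      using VF_T[OF \<open>x \<in> VF\<close>, of p] one unfolding tangent_space_def by blast
    then show ?thesis by simp
  qed
  then show ?thesis by (simp add: vapply_def fun_eq_iff)
qed

lemma nabla_eta_eq: "x \<in> VF \<Longrightarrow> y \<in> VF \<Longrightarrow> nabla_eta M D x y = g (D x \<xi>) y"
  using D_metric[of x y \<xi>] by (simp add: nabla_eta_def g_xi g_commute[of y])

text \<open>
  The Reeb field has constant length.
\<close>

lemma eta_D_xi: "x \<in> VF \<Longrightarrow> \<eta> (D x \<xi>) = 0"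
  using nabla_eta_eq[of x \<xi>] by (auto simp: nabla_eta_def g_xi vapply_one fun_eq_iff)

section \<open>The fundamental tensor\<close>

text \<open>
  The covariant derivative of the self-adjoint field $\phi$ is self-adjoint.
\<close>

lemma F_commute:
  assumes "x \<in> VF" "y \<in> VF" "z \<in> VF" shows "F x y z = F x z y"
proof -
  have "g (D x (\<phi> y)) z + g (\<phi> y) (D x z) = g (D x y) (\<phi> z) + g y (D x (\<phi> z))"
    using D_metric[of x "\<phi> y" z] D_metric[of x y "\<phi> z"] assms by (simp add: g_phi_left)
  then show ?thesis
    using assms g_commute[of "D x z" "\<phi> y"] g_commute[of "D x (\<phi> z)" y]
    by (simp add: fundamental_F_def g_diff g_phi_left algebra_simps)
qed

lemma F_zero [simp]:
  "x \<in> VF \<Longrightarrow> y \<in> VF \<Longrightarrow> F 0 x y = 0"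
  "x \<in> VF \<Longrightarrow> y \<in> VF \<Longrightarrow> F x 0 y = 0"
  "x \<in> VF \<Longrightarrow> y \<in> VF \<Longrightarrow> F x y 0 = 0"
  by (simp_all add: fundamental_F_def g_zero)

text \<open>
  \<open>F\<close> is a tensor. The following three lemmas state this for the combination
  $\phi^2x = x - \eta(x)\xi$ in each argument.
\<close>

lemma F_phi_phi_1:
  assumes "x \<in> VF" "y \<in> VF" "z \<in> VF" shows "F (\<phi> (\<phi> x)) y z = F x y z - \<eta> x * F \<xi> y z"
proof -
  have "D (\<phi> (\<phi> x)) (\<phi> y) - \<phi> (D (\<phi> (\<phi> x)) y)
      = (D x (\<phi> y) - \<phi> (D x y)) - \<eta> x \<odot> (D \<xi> (\<phi> y) - \<phi> (D \<xi> y))"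
    using assms
    by (simp add: D_phi_phi_left phi_diff_fmult)
       (simp add: fmult_def fun_eq_iff algebra_simps)
  then show ?thesis
    using assms by (simp add: fundamental_F_def g_diff_fmult)
qed

lemma F_phi_phi_3:
  assumes "x \<in> VF" "y \<in> VF" "z \<in> VF" shows "F x y (\<phi> (\<phi> z)) = F x y z - \<eta> z * F x y \<xi>"
proof -
  have "g w (\<phi> (\<phi> z)) = g w z - \<eta> z * g w \<xi>" if "w \<in> VF" for w
    using assms that
    by (simp add: phi_phi[of z] g_commute[of w] g_diff_fmult)
  then show ?thesis
    using assms by (simp add: fundamental_F_def)
qed

lemma F_phi_phi_2:
  assumes "x \<in> VF" "y \<in> VF" "z \<in> VF" shows "F x (\<phi> (\<phi> y)) z = F x y z - \<eta> y * F x \<xi> z"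
  using F_phi_phi_3[of x z y] assms by (simp add: F_commute[of x z])

text \<open>
  The Leibniz rule for $\phi^2 = I - \eta\otimes\xi$:
  $(\nabla_x\phi)\phi + \phi(\nabla_x\phi) = -(\nabla_x\eta)\otimes\xi - \eta\otimes\nabla_x\xi$.
\<close>

lemma F_phi_anticommute:
  assumes "x \<in> VF" "y \<in> VF" "z \<in> VF"
  shows "F x (\<phi> y) z + F x y (\<phi> z) =
    - (nabla_eta M D x y * \<eta> z) - \<eta> y * nabla_eta M D x z"
proof -
  have "F x (\<phi> y) z + F x y (\<phi> z) = g (D x (\<phi> (\<phi> y))) z - g (\<phi> (\<phi> (D x y))) z"
    using assms by (simp add: fundamental_F_def g_diff g_phi_left)
  also have "g (D x (\<phi> (\<phi> y))) z = g (D x y) z - \<eta> y * g (D x \<xi>) z - vapply x (\<eta> y) * \<eta> z"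
  proof -
    have "metric M p (D x y p - \<eta> y p *\<^sub>R D x \<xi> p - vapply x (\<eta> y) p *\<^sub>R \<xi> p) (z p)
      = metric M p (D x y p) (z p) - \<eta> y p * metric M p (D x \<xi> p) (z p)
        - vapply x (\<eta> y) p * metric M p (\<xi> p) (z p)" for p
      using assms by (simp add: metric_diff metric_scale)
    then have "g (D x (\<phi> (\<phi> y))) z = g (D x y) z - \<eta> y * g (D x \<xi>) z - vapply x (\<eta> y) * g \<xi> z"
      using assms by (simp add: D_phi_phi_right) (simp add: vg_def fmult_def fun_eq_iff)
    then show ?thesis using assms by (simp add: g_commute[of \<xi>] g_xi)
  qed
  also have "g (\<phi> (\<phi> (D x y))) z = g (D x y) z - \<eta> (D x y) * \<eta> z"
    using assms by (simp add: phi_phi[of "D x y"] g_diff_fmult g_commute[of \<xi>] g_xi)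
  finally show ?thesis
    using assms by (simp add: nabla_eta_eq[of x z]) (simp add: nabla_eta_def fun_eq_iff algebra_simps)
qed

lemma nabla_eta_F:
  assumes "x \<in> VF" "y \<in> VF" shows "nabla_eta M D x y = - F x (\<phi> y) \<xi>"
  using F_phi_anticommute[of x y \<xi>] assms
  by (simp add: nabla_eta_eq[of x \<xi>] g_xi eta_D_xi)

lemma F_phi_right:
  assumes "x \<in> VF" "y \<in> VF" "z \<in> VF"
  shows "F x y (\<phi> z) = \<eta> z * F x (\<phi> y) \<xi> + \<eta> y * F x (\<phi> z) \<xi> - F x (\<phi> y) z"
  using F_phi_anticommute[of x y z] assms by (simp add: nabla_eta_F algebra_simps)

lemma F_xi_xi: "x \<in> VF \<Longrightarrow> F x \<xi> \<xi> = 0"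
  by (simp add: fundamental_F_def g_minus g_xi)

section \<open>Nijenhuis tensors\<close>

lemma lie_xi_g_F:
  assumes "x \<in> VF" "y \<in> VF"
  shows "lie_xi_g M D x y = - F x (\<phi> y) \<xi> - F y (\<phi> x) \<xi>"
  using assms by (simp add: lie_xi_g_def nabla_eta_F)

text \<open>
  In the symmetric bracket of $\phi$ with itself, $\nabla_{\phi x}\phi y - \phi\nabla_{\phi x}y$ is
  $(\nabla_{\phi x}\phi)y$ and $\phi\nabla_x\phi y - \phi^2\nabla_xy$ is $\phi(\nabla_x\phi)y$.
\<close>

lemma Nhat1_cov_F:
  assumes "x \<in> VF" "y \<in> VF" "z \<in> VF"
  shows "Nhat1_cov M D x y z =
    F (\<phi> x) y z + F (\<phi> y) x z - F x y (\<phi> z) - F y x (\<phi> z)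
    + (F x (\<phi> y) \<xi> + F y (\<phi> x) \<xi>) * \<eta> z"
proof -
  have bracket: "g (phi_sym_bracket M D x y) z =
      F (\<phi> x) y z + F (\<phi> y) x z - F x y (\<phi> z) - F y x (\<phi> z)"
    using assms
    by (simp add: phi_sym_bracket_def sym_bracket_def fundamental_F_def
        g_diff g_add phi_add g_phi_left)
  have "Nhat1_cov M D x y z = g (phi_sym_bracket M D x y) z - lie_xi_g M D x y * \<eta> z"
    using assms
    by (simp add: Nhat1_cov_def Nhat1_def phi_sym_bracket_def sym_bracket_def
        g_diff_fmult g_commute[of \<xi> z] g_xi)
  then show ?thesis
    using assms by (simp add: bracket lie_xi_g_F fun_eq_iff algebra_simps)
qed

lemma Nhat2_F:
  assumes "x \<in> VF" "y \<in> VF"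
  shows "Nhat2 M D x y =
    - F (\<phi> x) (\<phi> y) \<xi> - F (\<phi> y) (\<phi> x) \<xi> - F x (\<phi> (\<phi> y)) \<xi> - F y (\<phi> (\<phi> x)) \<xi>"
  using assms by (simp add: Nhat2_def lie_xi_g_F algebra_simps)

lemma Nhat3_cov_F:
  assumes "x \<in> VF" "z \<in> VF"
  shows "Nhat3_cov M D x z = F \<xi> x z + F x \<xi> z - F (\<phi> x) (\<phi> z) \<xi>"
proof -
  have "F (\<phi> x) (\<phi> z) \<xi> = - g (D (\<phi> x) \<xi>) z"
    using nabla_eta_F[of "\<phi> x" z] nabla_eta_eq[of "\<phi> x" z] assms by simp
  then show ?thesis
    using assms
    by (simp add: Nhat3_cov_def Nhat3_def sym_bracket_def fundamental_F_def
        g_diff g_add g_minus phi_add g_phi_left)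
qed

lemma Nhat4_F:
  assumes "x \<in> VF" shows "Nhat4 M D x = - omega M D (\<phi> x)"
  using assms by (simp add: Nhat4_def lie_xi_g_F omega_def F_commute[of \<xi> \<xi> "\<phi> x"])

lemma Nhat1_eq_0I:
  assumes "x \<in> VF" "y \<in> VF" "\<And>z. z \<in> VF \<Longrightarrow> Nhat1_cov M D x y z = 0"
  shows "Nhat1 M D x y = 0"
  unfolding Nhat1_def
proof (rule vector_field_eq_0I)
  show "phi_sym_bracket M D x y \<in> VF"
    using assms(1,2) by (simp add: phi_sym_bracket_def sym_bracket_def)
  show "g (phi_sym_bracket M D x y - lie_xi_g M D x y \<odot> \<xi>) z = 0" if "z \<in> VF" for z
    using assms(3)[OF that] by (simp only: Nhat1_cov_def Nhat1_def)
qed (rule xi_VF)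

lemma Nhat3_eq_0I:
  assumes "x \<in> VF" "\<And>z. z \<in> VF \<Longrightarrow> Nhat3_cov M D x z = 0"
  shows "Nhat3 M D x = 0"
proof -
  have "Nhat3 M D x - 0 \<odot> \<xi> = 0"
  proof (rule vector_field_eq_0I)
    show "Nhat3 M D x \<in> VF"
      using assms(1) by (simp add: Nhat3_def sym_bracket_def)
    show "g (Nhat3 M D x - 0 \<odot> \<xi>) z = 0" if "z \<in> VF" for z
      using assms(2)[OF that] by (simp add: Nhat3_cov_def)
  qed (rule xi_VF)
  then show ?thesis by simp
qed

section \<open>Horizontal fundamental tensors\<close>

lemma F_class:
  assumes "in_basic_class n M D i" "x \<in> VF" "y \<in> VF" "z \<in> VF"
  shows "F x y z = F_comp n M D i x y z"
  using assms by (simp add: in_basic_class_def)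

text \<open>
  In $F_1$, $F_2$, $F_3$ the last argument enters only through its image under $\phi$, so it may be
  replaced by 0 when it is $\xi$, and $F(x,y,0) = 0$. With $\xi$ as first argument each term vanishes.
\<close>

lemma F_xi_horizontal:
  assumes "in_basic_class n M D i" "i \<in> {1, 2, 3}" "x \<in> VF" "y \<in> VF"
  shows "F x y \<xi> = 0" "F \<xi> x y = 0"
proof -
  have "F x y \<xi> = F_comp n M D i x y \<xi>" "F x y 0 = F_comp n M D i x y 0"
    "F \<xi> x y = F_comp n M D i \<xi> x y"
    using F_class assms by simp_all
  moreover have "F_comp n M D i x y \<xi> = F_comp n M D i x y 0"
    using assms(2-) unfolding F_comp_def Let_def by (elim insertE emptyE) (simp_all add: g_zero)
  moreover have "F_comp n M D i \<xi> x y = 0"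
    using assms(2-) unfolding F_comp_def Let_def
    by (elim insertE emptyE) (simp_all add: g_zero g_commute[of \<xi>] g_xi)
  ultimately show "F x y \<xi> = 0" "F \<xi> x y = 0"
    using assms by simp_all
qed

lemma Nhat_horizontal:
  assumes F_v: "\<And>u v. u \<in> VF \<Longrightarrow> v \<in> VF \<Longrightarrow> F u v \<xi> = 0"
    and F_h: "\<And>u v. u \<in> VF \<Longrightarrow> v \<in> VF \<Longrightarrow> F \<xi> u v = 0"
    and "x \<in> VF" "y \<in> VF"
  shows "z \<in> VF \<Longrightarrow>
      Nhat1_cov M D x y z = F (\<phi> x) y z + F (\<phi> y) x z - F x y (\<phi> z) - F y x (\<phi> z)"
    and "Nhat2 M D x y = 0" "Nhat3 M D x = 0" "Nhat4 M D x = 0"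
proof -
  have v: "F u \<xi> w = 0" if "u \<in> VF" "w \<in> VF" for u w
    using F_commute[of u \<xi> w] F_v that by simp
  show "Nhat1_cov M D x y z = F (\<phi> x) y z + F (\<phi> y) x z - F x y (\<phi> z) - F y x (\<phi> z)"
    if "z \<in> VF"
    using that assms by (simp add: Nhat1_cov_F)
  show "Nhat2 M D x y = 0"
    using assms by (simp add: Nhat2_F)
  show "Nhat3 M D x = 0"
    by (rule Nhat3_eq_0I) (use assms v in \<open>simp_all add: Nhat3_cov_F\<close>)
  show "Nhat4 M D x = 0"
    using assms by (simp add: Nhat4_F omega_def)
qed

lemma F_comp_1:
  "F_comp n M D 1 x y z = (1 / (2 * real n)) *\<^sub>R
    (g (\<phi> x) (\<phi> y) * theta n M D (\<phi> (\<phi> z)) + g (\<phi> x) (\<phi> z) * theta n M D (\<phi> (\<phi> y))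
     - g x (\<phi> y) * theta n M D (\<phi> z) - g x (\<phi> z) * theta n M D (\<phi> y))"
  by (simp add: F_comp_def Let_def)

text \<open>
  The terms of $F_1$ that contain $\theta(\phi y)$ and $\theta(\phi^2y)$ cancel; the result is symmetric in \<open>x\<close>, \<open>y\<close>.
\<close>

lemma F_comp_1_shift:
  assumes "x \<in> VF" "y \<in> VF" "z \<in> VF"
  shows "F_comp n M D 1 (\<phi> x) y z - F_comp n M D 1 x y (\<phi> z) =
    (1 / real n) *\<^sub>R (g x (\<phi> y) * theta n M D (\<phi> (\<phi> z)) - g (\<phi> x) (\<phi> y) * theta n M D (\<phi> z))"
proof -
  have "g (\<phi> (\<phi> x)) (\<phi> y) = g x (\<phi> y)" "g (\<phi> (\<phi> x)) (\<phi> z) = g x (\<phi> z)"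
    "g (\<phi> x) (\<phi> (\<phi> z)) = g x (\<phi> z)" "g x (\<phi> (\<phi> z)) = g (\<phi> x) (\<phi> z)"
    using assms by (simp_all only: g_phi_left phi_phi_phi phi_VF)
  then have "F_comp n M D 1 (\<phi> x) y z = (1 / (2 * real n)) *\<^sub>R
      (g x (\<phi> y) * theta n M D (\<phi> (\<phi> z)) + g x (\<phi> z) * theta n M D (\<phi> (\<phi> y))
       - g (\<phi> x) (\<phi> y) * theta n M D (\<phi> z) - g (\<phi> x) (\<phi> z) * theta n M D (\<phi> y))"
    "F_comp n M D 1 x y (\<phi> z) = (1 / (2 * real n)) *\<^sub>R
      (g (\<phi> x) (\<phi> y) * theta n M D (\<phi> z) + g x (\<phi> z) * theta n M D (\<phi> (\<phi> y))
       - g x (\<phi> y) * theta n M D (\<phi> (\<phi> z)) - g (\<phi> x) (\<phi> z) * theta n M D (\<phi> y))"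
    using assms by (simp_all only: F_comp_1 phi_phi_phi phi_VF)
  then show ?thesis
    by (simp only:) (intro ext, simp add: field_simps)
qed

text \<open>
  Four times the projection $F_1 + F_2$ of \<open>F\<close>, for a horizontal \<open>F\<close>.
\<close>

definition F12 where
  "F12 x y z = 2 *\<^sub>R F x y z + F y z x + F z x y - F (\<phi> y) (\<phi> z) x - F (\<phi> z) (\<phi> y) x"

text \<open>
  On horizontal \<open>F\<close>, moving $\phi$ between the last two arguments changes the sign. With
  $a = F(\phi x,y,z)$, $b = F(\phi y,x,z)$, $c = F(x,y,\phi z)$, $d = F(y,x,\phi z)$, the terms involving
  $F(\phi z,x,y)$ and $F(z,x,\phi y)$ cancel in the difference, and $2(a + b - c - d)$ remains.
\<close>

lemma F12_shift:
  assumes F_v: "\<And>u v. u \<in> VF \<Longrightarrow> v \<in> VF \<Longrightarrow> F u v \<xi> = 0"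
    and F_h: "\<And>u v. u \<in> VF \<Longrightarrow> v \<in> VF \<Longrightarrow> F \<xi> u v = 0"
    and VF: "x \<in> VF" "y \<in> VF" "z \<in> VF"
  shows "F12 (\<phi> x) y z - F12 x y (\<phi> z) =
    2 *\<^sub>R (F (\<phi> x) y z + F (\<phi> y) x z - F x y (\<phi> z) - F y x (\<phi> z))"
proof -
  have phi2: "F u (\<phi> v) w = - F u v (\<phi> w)" if "u \<in> VF" "v \<in> VF" "w \<in> VF" for u v w
    using F_phi_right[of u v w] F_v that by simp
  have hor: "F (\<phi> (\<phi> u)) v w = F u v w" "F u v (\<phi> (\<phi> w)) = F u v w"
    if "u \<in> VF" "v \<in> VF" "w \<in> VF" for u v w
    using that F_v F_h by (simp_all add: F_phi_phi_1 F_phi_phi_3)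
  have com: "F (\<phi> y) z x = F (\<phi> y) x z" "F (\<phi> z) y x = F (\<phi> z) x y"
    "F y z (\<phi> x) = - F y x (\<phi> z)" "F z y (\<phi> x) = - F z x (\<phi> y)"
    using VF F_commute[of "\<phi> y" z x] F_commute[of "\<phi> z" y x] F_commute[of y z "\<phi> x"]
      F_commute[of z y "\<phi> x"] by (simp_all add: phi2)
  show ?thesis
    using VF by (simp add: F12_def phi2 hor com) (intro ext, simp)
qed

lemma F_comp_F12:
  assumes F_v: "\<And>u v. u \<in> VF \<Longrightarrow> v \<in> VF \<Longrightarrow> F u v \<xi> = 0"
    and F_h: "\<And>u v. u \<in> VF \<Longrightarrow> v \<in> VF \<Longrightarrow> F \<xi> u v = 0"
    and VF: "x \<in> VF" "y \<in> VF" "z \<in> VF"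
  shows "F_comp n M D 2 x y z = (1/4) *\<^sub>R F12 x y z - F_comp n M D 1 x y z"
    and "F_comp n M D 3 x y z = F x y z - (1/4) *\<^sub>R F12 x y z"
proof -
  have hor: "F (\<phi> (\<phi> u)) v w = F u v w" "F u v (\<phi> (\<phi> w)) = F u v w"
      "F u (\<phi> (\<phi> v)) w = F u v w"
    if "u \<in> VF" "v \<in> VF" "w \<in> VF" for u v w
    using that F_v F_h F_commute[of u \<xi> w] by (simp_all add: F_phi_phi_1 F_phi_phi_2 F_phi_phi_3)
  show "F_comp n M D 2 x y z = (1/4) *\<^sub>R F12 x y z - F_comp n M D 1 x y z"
    using VF by (simp add: F_comp_def Let_def F12_def hor)
  show "F_comp n M D 3 x y z = F x y z - (1/4) *\<^sub>R F12 x y z"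
    using VF by (simp add: F_comp_def Let_def F12_def hor) (intro ext, simp add: field_simps)
qed

lemma Nhat_class_1:
  assumes C: "in_basic_class n M D 1" and VF: "x \<in> VF" "y \<in> VF"
  shows "z \<in> VF \<Longrightarrow> Nhat1_cov M D x y z =
          (2 / real n) *\<^sub>R (g x (\<phi> y) * theta n M D (\<phi> (\<phi> z))
                          - g (\<phi> x) (\<phi> y) * theta n M D (\<phi> z))"
    and "Nhat2 M D x y = 0" "Nhat3 M D x = 0" "Nhat4 M D x = 0"
proof -
  note hor = F_xi_horizontal[OF C, simplified]
  show "Nhat2 M D x y = 0" "Nhat3 M D x = 0" "Nhat4 M D x = 0"
    using Nhat_horizontal[OF hor VF] by auto
  assume z: "z \<in> VF"
  have "F (\<phi> x) y z - F x y (\<phi> z) =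
      (1 / real n) *\<^sub>R (g x (\<phi> y) * theta n M D (\<phi> (\<phi> z)) - g (\<phi> x) (\<phi> y) * theta n M D (\<phi> z))"
    using F_comp_1_shift[of x y z] F_class[OF C] VF z by simp
  moreover have "F (\<phi> y) x z - F y x (\<phi> z) =
      (1 / real n) *\<^sub>R (g x (\<phi> y) * theta n M D (\<phi> (\<phi> z)) - g (\<phi> x) (\<phi> y) * theta n M D (\<phi> z))"
    using F_comp_1_shift[of y x z] F_class[OF C] VF z g_commute[of "\<phi> x" "\<phi> y"] g_commute[of "\<phi> x" y]
    by (simp add: g_phi_left)
  moreover have "Nhat1_cov M D x y z =
      (F (\<phi> x) y z - F x y (\<phi> z)) + (F (\<phi> y) x z - F y x (\<phi> z))"
    using Nhat_horizontal(1)[OF hor VF z] by simp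
  ultimately show "Nhat1_cov M D x y z =
          (2 / real n) *\<^sub>R (g x (\<phi> y) * theta n M D (\<phi> (\<phi> z))
                          - g (\<phi> x) (\<phi> y) * theta n M D (\<phi> z))"
    by (simp only: scaleR_add_left[symmetric]) simp
qed

text \<open>
  Write $G(x,y)$ for $F(\phi x,y,z) - F(x,y,\phi z)$, so that $\widehat N^{(1)}(x,y,z) = G(x,y) + G(y,x)$.
  Since $F = F_2$ is \<open>F12 / 4\<close> minus $F_1$, \<open>F12_shift\<close> and \<open>F_comp_1_shift\<close> express $G(x,y)$ by
  quantities symmetric in \<open>x\<close>, \<open>y\<close>. Hence $\widehat N^{(1)}(x,y,z) = 2\,G(x,y)$.
\<close>

lemma Nhat_class_2:
  assumes C: "in_basic_class n M D 2" and VF: "x \<in> VF" "y \<in> VF"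
  shows "z \<in> VF \<Longrightarrow> Nhat1_cov M D x y z =
          (-2) *\<^sub>R (F (\<phi> x) (\<phi> y) (\<phi> z) + F (\<phi> (\<phi> x)) (\<phi> (\<phi> y)) (\<phi> z))"
    and "Nhat2 M D x y = 0" "Nhat3 M D x = 0" "Nhat4 M D x = 0"
proof -
  note hor = F_xi_horizontal[OF C, simplified]
  show "Nhat2 M D x y = 0" "Nhat3 M D x = 0" "Nhat4 M D x = 0"
    using Nhat_horizontal[OF hor VF] by auto
  assume z: "z \<in> VF"
  define R where "R u v = F_comp n M D 1 (\<phi> u) v z - F_comp n M D 1 u v (\<phi> z)" for u v
  define N where "N u v = F (\<phi> u) v z + F (\<phi> v) u z - F u v (\<phi> z) - F v u (\<phi> z)" for u v
  have G: "F (\<phi> u) v z - F u v (\<phi> z) = (1/2) *\<^sub>R N u v - R u v" if "u \<in> VF" "v \<in> VF" for u v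
  proof -
    have "F (\<phi> u) v z = (1/4) *\<^sub>R F12 (\<phi> u) v z - F_comp n M D 1 (\<phi> u) v z"
      "F u v (\<phi> z) = (1/4) *\<^sub>R F12 u v (\<phi> z) - F_comp n M D 1 u v (\<phi> z)"
      using F_class[OF C] F_comp_F12(1)[OF hor] that z by simp_all
    then have "F (\<phi> u) v z - F u v (\<phi> z) = (1/4) *\<^sub>R (F12 (\<phi> u) v z - F12 u v (\<phi> z)) - R u v"
      by (simp add: R_def scaleR_diff_right)
    also have "F12 (\<phi> u) v z - F12 u v (\<phi> z) = 2 *\<^sub>R N u v"
      using F12_shift[OF hor that z] by (simp only: N_def)
    also have "(1/4) *\<^sub>R 2 *\<^sub>R N u v = (1/2) *\<^sub>R N u v"
      by simp
    finally show ?thesis .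
  qed
  have "R y x = R x y"
    using F_comp_1_shift[of y x z] F_comp_1_shift[of x y z] VF z
      g_commute[of "\<phi> x" "\<phi> y"] g_commute[of "\<phi> x" y]
    by (simp add: R_def g_phi_left)
  moreover have "N y x = N x y"
    by (simp add: N_def)
  ultimately have "F (\<phi> y) x z - F y x (\<phi> z) = F (\<phi> x) y z - F x y (\<phi> z)"
    by (simp only: G VF)
  moreover have "N x y = (F (\<phi> x) y z - F x y (\<phi> z)) + (F (\<phi> y) x z - F y x (\<phi> z))"
    by (simp add: N_def)
  ultimately have "N x y = 2 *\<^sub>R (F (\<phi> x) y z - F x y (\<phi> z))"
    by (simp only: scaleR_2)
  moreover have "Nhat1_cov M D x y z = N x y"
    using Nhat_horizontal(1)[OF hor VF z] by (simp only: N_def)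
  moreover have "F (\<phi> x) (\<phi> y) (\<phi> z) = - F (\<phi> x) y z"
    "F (\<phi> (\<phi> x)) (\<phi> (\<phi> y)) (\<phi> z) = F x y (\<phi> z)"
    using VF z hor F_commute[of x \<xi> "\<phi> z"] F_commute[of "\<phi> x" \<xi> z]
    by (simp_all add: F_phi_right[of _ "\<phi> y"] F_phi_phi_1 F_phi_phi_2)
  ultimately show "Nhat1_cov M D x y z =
          (-2) *\<^sub>R (F (\<phi> x) (\<phi> y) (\<phi> z) + F (\<phi> (\<phi> x)) (\<phi> (\<phi> y)) (\<phi> z))"
    by (simp only:) (intro ext, simp add: algebra_simps)
qed

text \<open>
  Here $F = F_3 = F$ minus \<open>F12 / 4\<close>, so \<open>F12\<close> vanishes, and $\widehat N^{(1)}$ with it by \<open>F12_shift\<close>.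
\<close>

lemma Nhat_class_3:
  assumes C: "in_basic_class n M D 3" and VF: "x \<in> VF" "y \<in> VF"
  shows "Nhat1 M D x y = 0" "Nhat2 M D x y = 0" "Nhat3 M D x = 0" "Nhat4 M D x = 0"
proof -
  note hor = F_xi_horizontal[OF C, simplified]
  show "Nhat2 M D x y = 0" "Nhat3 M D x = 0" "Nhat4 M D x = 0"
    using Nhat_horizontal[OF hor VF] by auto
  have "F12 u v w = 0" if "u \<in> VF" "v \<in> VF" "w \<in> VF" for u v w
    using F_class[OF C that] F_comp_F12(2)[OF hor that] by simp
  then have "Nhat1_cov M D x y z = 0" if "z \<in> VF" for z
    using Nhat_horizontal(1)[OF hor VF that] F12_shift[OF hor VF that] VF that by simp
  then show "Nhat1 M D x y = 0"
    by (intro Nhat1_eq_0I VF)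
qed

section \<open>Vertical fundamental tensors\<close>

text \<open>
  The common shape of the classes 4 to 9: $F = [S]$ with $S$ horizontal, and $\phi$ scaling \<open>S\<close> by \<open>e\<close>.
  In the classes 4 to 7 the factor \<open>e\<close> is 1, in the classes 8 and 9 it is $-1$.
\<close>

definition vertical :: "real \<Rightarrow> ('m vfield \<Rightarrow> 'm vfield \<Rightarrow> 'm \<Rightarrow> real) \<Rightarrow> bool" where
  "vertical e S \<longleftrightarrow>
    (\<forall>u\<in>VF. \<forall>v\<in>VF. \<forall>w\<in>VF. F u v w = sq_ext M S u v w) \<and>
    (\<forall>u\<in>VF. S u \<xi> = 0 \<and> S \<xi> u = 0) \<and>
    (\<forall>u\<in>VF. \<forall>v\<in>VF. S (\<phi> u) (\<phi> v) = e *\<^sub>R S u v)"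

text \<open>
  Since $F(x,y,\xi) = S(x,y)$ and $S$ is horizontal, $S(\phi x,y) = S(\phi x,\phi^2y) = e\,S(x,\phi y)$. Every
  term of the Nijenhuis tensors is thereby a multiple of $S(x,\phi y)$, $S(y,\phi x)$, $S(x,\phi z)$ or
  $S(y,\phi z)$ for $\widehat N^{(1)}$, and of $S$ itself for $\widehat N^{(2)}$ and $\widehat N^{(3)}$.
\<close>

lemma Nhat_vertical:
  assumes vert: "vertical e S" and VF: "x \<in> VF" "y \<in> VF"
  shows "F x y \<xi> = S x y"
    and "F (\<phi> x) y \<xi> = e *\<^sub>R F x (\<phi> y) \<xi>"
    and "z \<in> VF \<Longrightarrow> Nhat1_cov M D x y z =
        (1 + e) *\<^sub>R ((F x (\<phi> y) \<xi> + F y (\<phi> x) \<xi>) * \<eta> z)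
        + (e - 1) *\<^sub>R (\<eta> x * F y (\<phi> z) \<xi> + \<eta> y * F x (\<phi> z) \<xi>)"
    and "Nhat2 M D x y = - ((1 + e) *\<^sub>R (F x y \<xi> + F y x \<xi>))"
    and "z \<in> VF \<Longrightarrow> Nhat3_cov M D x z = (1 - e) *\<^sub>R F x z \<xi>"
    and "Nhat4 M D x = 0"
proof -
  have F_S: "F u v w = sq_ext M S u v w" if "u \<in> VF" "v \<in> VF" "w \<in> VF" for u v w
    using vert that by (simp add: vertical_def)
  have S_xi: "S u \<xi> = 0" "S \<xi> u = 0" if "u \<in> VF" for u
    using vert that by (simp_all add: vertical_def)
  have S_phi: "S (\<phi> u) (\<phi> v) = e *\<^sub>R S u v" if "u \<in> VF" "v \<in> VF" for u v
    using vert that by (simp add: vertical_def)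
  have F_xi: "F u v \<xi> = S u v" if "u \<in> VF" "v \<in> VF" for u v
    using that by (simp add: F_S sq_ext_def S_xi)
  have S_phi_phi: "S u (\<phi> (\<phi> v)) = S u v" if "u \<in> VF" "v \<in> VF" for u v
    using F_phi_phi_2[of u v \<xi>] that by (simp add: F_xi S_xi)
  have S_shift: "S (\<phi> u) v = e *\<^sub>R S u (\<phi> v)" if "u \<in> VF" "v \<in> VF" for u v
    using S_phi[of u "\<phi> v"] S_phi_phi[of "\<phi> u" v] that by simp
  show "F x y \<xi> = S x y" "F (\<phi> x) y \<xi> = e *\<^sub>R F x (\<phi> y) \<xi>"
    using VF by (simp_all add: F_xi S_shift)
  show "Nhat1_cov M D x y z =
        (1 + e) *\<^sub>R ((F x (\<phi> y) \<xi> + F y (\<phi> x) \<xi>) * \<eta> z)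
        + (e - 1) *\<^sub>R (\<eta> x * F y (\<phi> z) \<xi> + \<eta> y * F x (\<phi> z) \<xi>)" if "z \<in> VF"
  proof -
    have "Nhat1_cov M D x y z =
        (e *\<^sub>R S x (\<phi> y) * \<eta> z + e *\<^sub>R S x (\<phi> z) * \<eta> y) + (e *\<^sub>R S y (\<phi> x) * \<eta> z + e *\<^sub>R S y (\<phi> z) * \<eta> x)
        - S x (\<phi> z) * \<eta> y - S y (\<phi> z) * \<eta> x + (S x (\<phi> y) + S y (\<phi> x)) * \<eta> z"
      using VF that by (simp add: Nhat1_cov_F F_xi) (simp add: F_S sq_ext_def S_shift)
    then show ?thesis
      using VF that by (simp only: F_xi phi_VF) (intro ext, simp add: algebra_simps)
  qed
  show "Nhat2 M D x y = - ((1 + e) *\<^sub>R (F x y \<xi> + F y x \<xi>))"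
    using VF by (simp add: Nhat2_F F_xi S_phi S_phi_phi) (intro ext, simp add: algebra_simps)
  show "Nhat3_cov M D x z = (1 - e) *\<^sub>R F x z \<xi>" if "z \<in> VF"
    using VF that
    by (simp add: Nhat3_cov_F F_xi S_phi) (simp add: F_S sq_ext_def S_xi scaleR_diff_left)
  show "Nhat4 M D x = 0"
    using VF by (simp add: Nhat4_F omega_def F_S sq_ext_def S_xi)
qed

corollary Nhat_vertical_symmetric:
  assumes vert: "vertical 1 S" and sym: "\<And>u v. u \<in> VF \<Longrightarrow> v \<in> VF \<Longrightarrow> S v u = S u v"
    and VF: "x \<in> VF" "y \<in> VF"
  shows "z \<in> VF \<Longrightarrow> Nhat1_cov M D x y z = 4 *\<^sub>R (F x (\<phi> y) \<xi> * \<eta> z)"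
    and "Nhat2 M D x y = (-4) *\<^sub>R F x y \<xi>"
    and "Nhat3 M D x = 0" "Nhat4 M D x = 0"
proof -
  note N = Nhat_vertical[OF vert]
  have F_sym: "F v u \<xi> = F u v \<xi>" if "u \<in> VF" "v \<in> VF" for u v
    using N(1) sym that by simp
  have "F y (\<phi> x) \<xi> = F x (\<phi> y) \<xi>"
    using F_sym[of "\<phi> x" y] N(2)[OF VF] VF by simp
  then show "Nhat1_cov M D x y z = 4 *\<^sub>R (F x (\<phi> y) \<xi> * \<eta> z)" if "z \<in> VF"
    using N(3)[OF VF that] by (simp add: fun_eq_iff)
  show "Nhat2 M D x y = (-4) *\<^sub>R F x y \<xi>"
    using N(4)[OF VF] F_sym[OF VF] by (simp add: fun_eq_iff)
  show "Nhat3 M D x = 0"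
    by (rule Nhat3_eq_0I) (use N(5)[OF VF] VF in simp_all)
  show "Nhat4 M D x = 0"
    by (rule N(6)[OF VF])
qed

text \<open>
  Composing with $\phi$ exchanges \<open>b\<close> and \<open>c\<close>, because $\phi^3 = \phi$. This is what makes $b + c$
  invariant under $\phi$ and $b - c$ change its sign.
\<close>

lemma bc_tensor_phi:
  assumes "u \<in> VF" "v \<in> VF"
  shows "b_tensor M D u \<xi> = 0" "b_tensor M D \<xi> u = 0" "c_tensor M D u \<xi> = 0" "c_tensor M D \<xi> u = 0"
    "b_tensor M D (\<phi> u) (\<phi> v) = c_tensor M D u v" "c_tensor M D (\<phi> u) (\<phi> v) = b_tensor M D u v"
  using assms by (simp_all add: b_tensor_def c_tensor_def)

lemma g_phi_phi_phi:
  assumes "u \<in> VF" "v \<in> VF"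
  shows "g (\<phi> (\<phi> u)) (\<phi> (\<phi> v)) = g (\<phi> u) (\<phi> v)" "g (\<phi> u) (\<phi> (\<phi> v)) = g u (\<phi> v)"
    "g \<xi> (\<phi> v) = 0"
  using assms g_commute[of \<xi> "\<phi> v"] by (simp_all add: g_phi_left g_xi)

lemma vertical_4:
  assumes C: "in_basic_class n M D 4"
  shows "vertical 1 (\<lambda>u v. (1 / (2 * real n)) *\<^sub>R (theta n M D \<xi> * g (\<phi> u) (\<phi> v)))"
    (is "vertical 1 ?S")
  unfolding vertical_def
proof (intro conjI ballI)
  show "F u v w = sq_ext M ?S u v w" if "u \<in> VF" "v \<in> VF" "w \<in> VF" for u v w
    unfolding F_class[OF C that] F_comp_def Let_def
    by (simp add: sq_ext_def) (intro ext, simp add: algebra_simps)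
  show "?S u \<xi> = 0" "?S \<xi> u = 0" if "u \<in> VF" for u
    using that by (simp_all add: g_zero g_phi_phi_phi)
  show "?S (\<phi> u) (\<phi> v) = 1 *\<^sub>R ?S u v" if "u \<in> VF" "v \<in> VF" for u v
    using that by (simp add: g_phi_phi_phi)
qed

lemma vertical_5:
  assumes C: "in_basic_class n M D 5"
  shows "vertical 1 (\<lambda>u v. (1 / (2 * real n)) *\<^sub>R (theta_star n M D \<xi> * g u (\<phi> v)))"
    (is "vertical 1 ?S")
  unfolding vertical_def
proof (intro conjI ballI)
  show "F u v w = sq_ext M ?S u v w" if "u \<in> VF" "v \<in> VF" "w \<in> VF" for u v w
    unfolding F_class[OF C that] F_comp_def Let_def
    by (simp add: sq_ext_def) (intro ext, simp add: algebra_simps)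
  show "?S u \<xi> = 0" "?S \<xi> u = 0" if "u \<in> VF" for u
    using that by (simp_all add: g_zero g_phi_phi_phi)
  show "?S (\<phi> u) (\<phi> v) = 1 *\<^sub>R ?S u v" if "u \<in> VF" "v \<in> VF" for u v
    using that by (simp add: g_phi_phi_phi)
qed

lemma Nhat_class_4:
  assumes C: "in_basic_class n M D 4" and VF: "x \<in> VF" "y \<in> VF"
  shows "z \<in> VF \<Longrightarrow> Nhat1_cov M D x y z =
      (2 / real n) *\<^sub>R (theta n M D \<xi> * g x (\<phi> y) * \<eta> z)"
    and "Nhat2 M D x y = (- 2 / real n) *\<^sub>R (theta n M D \<xi> * g (\<phi> x) (\<phi> y))"
    and "Nhat3 M D x = 0" "Nhat4 M D x = 0"
proof -
  note vert = vertical_4[OF C]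
  note N = Nhat_vertical_symmetric[OF vert _ VF] and F_xi = Nhat_vertical(1)[OF vert]
  have sym: "(1 / (2 * real n)) *\<^sub>R (theta n M D \<xi> * g (\<phi> v) (\<phi> u)) =
      (1 / (2 * real n)) *\<^sub>R (theta n M D \<xi> * g (\<phi> u) (\<phi> v))" if "u \<in> VF" "v \<in> VF" for u v
    using that g_commute[of "\<phi> v" "\<phi> u"] by simp
  show "Nhat1_cov M D x y z = (2 / real n) *\<^sub>R (theta n M D \<xi> * g x (\<phi> y) * \<eta> z)" if "z \<in> VF"
    using N(1)[OF sym that] VF by (simp add: F_xi g_phi_phi_phi fun_eq_iff)
  show "Nhat2 M D x y = (- 2 / real n) *\<^sub>R (theta n M D \<xi> * g (\<phi> x) (\<phi> y))"
    using N(2)[OF sym] VF by (simp add: F_xi fun_eq_iff)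
  show "Nhat3 M D x = 0" "Nhat4 M D x = 0"
    using N(3,4)[OF sym] by simp_all
qed

lemma Nhat_class_5:
  assumes C: "in_basic_class n M D 5" and VF: "x \<in> VF" "y \<in> VF"
  shows "z \<in> VF \<Longrightarrow> Nhat1_cov M D x y z =
      (2 / real n) *\<^sub>R (theta_star n M D \<xi> * g (\<phi> x) (\<phi> y) * \<eta> z)"
    and "Nhat2 M D x y = (- 2 / real n) *\<^sub>R (theta_star n M D \<xi> * g x (\<phi> y))"
    and "Nhat3 M D x = 0" "Nhat4 M D x = 0"
proof -
  note vert = vertical_5[OF C]
  note N = Nhat_vertical_symmetric[OF vert _ VF] and F_xi = Nhat_vertical(1)[OF vert]
  have sym: "(1 / (2 * real n)) *\<^sub>R (theta_star n M D \<xi> * g v (\<phi> u)) =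
      (1 / (2 * real n)) *\<^sub>R (theta_star n M D \<xi> * g u (\<phi> v))" if "u \<in> VF" "v \<in> VF" for u v
    using that g_commute[of v "\<phi> u"] g_phi_left[of u v] by simp
  show "Nhat1_cov M D x y z = (2 / real n) *\<^sub>R (theta_star n M D \<xi> * g (\<phi> x) (\<phi> y) * \<eta> z)"
    if "z \<in> VF"
    using N(1)[OF sym that] VF by (simp add: F_xi g_phi_left fun_eq_iff)
  show "Nhat2 M D x y = (- 2 / real n) *\<^sub>R (theta_star n M D \<xi> * g x (\<phi> y))"
    using N(2)[OF sym] VF by (simp add: F_xi fun_eq_iff)
  show "Nhat3 M D x = 0" "Nhat4 M D x = 0"
    using N(3,4)[OF sym] by simp_all
qed

lemma Nhat_class_6:
  assumes C: "in_basic_class n M D 6" and VF: "x \<in> VF" "y \<in> VF"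
  shows "z \<in> VF \<Longrightarrow> Nhat1_cov M D x y z = 4 *\<^sub>R (F x (\<phi> y) \<xi> * \<eta> z)"
    and "Nhat2 M D x y = (-4) *\<^sub>R F x y \<xi>"
    and "Nhat3 M D x = 0" "Nhat4 M D x = 0"
proof -
  define S where "S u v =
      (1/4) *\<^sub>R (b_tensor M D u v + b_tensor M D v u + c_tensor M D u v + c_tensor M D v u)
      - (1 / (2 * real n)) *\<^sub>R (theta n M D \<xi> * g (\<phi> u) (\<phi> v))
      - (1 / (2 * real n)) *\<^sub>R (theta_star n M D \<xi> * g u (\<phi> v))" for u v
  have sym: "S v u = S u v" if "u \<in> VF" "v \<in> VF" for u v
    using that g_commute[of "\<phi> v" "\<phi> u"] g_commute[of v "\<phi> u"] g_phi_left[of u v]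
    by (simp add: S_def ac_simps)
  have "vertical 1 S"
    unfolding vertical_def
  proof (intro conjI ballI)
    show "F u v w = sq_ext M S u v w" if "u \<in> VF" "v \<in> VF" "w \<in> VF" for u v w
      using F_class[OF C that] unfolding F_comp_def Let_def
      by (simp add: sq_ext_def S_def) (intro ext, simp add: algebra_simps)
    show "S u \<xi> = 0" "S \<xi> u = 0" if "u \<in> VF" for u
      using that by (simp_all add: S_def bc_tensor_phi g_zero g_phi_phi_phi)
    show "S (\<phi> u) (\<phi> v) = 1 *\<^sub>R S u v" if "u \<in> VF" "v \<in> VF" for u v
      using that by (simp add: S_def bc_tensor_phi g_phi_phi_phi ac_simps)
  qed
  note N = Nhat_vertical_symmetric[OF this sym VF]
  show "z \<in> VF \<Longrightarrow> Nhat1_cov M D x y z = 4 *\<^sub>R (F x (\<phi> y) \<xi> * \<eta> z)"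
    "Nhat2 M D x y = (-4) *\<^sub>R F x y \<xi>" "Nhat3 M D x = 0" "Nhat4 M D x = 0"
    by (rule N; assumption)+
qed

text \<open>
  \<open>S\<close> is antisymmetric, and it enters $\widehat N^{(1)}$ and $\widehat N^{(2)}$ only through its symmetrization.
\<close>

lemma Nhat_class_7:
  assumes C: "in_basic_class n M D 7" and VF: "x \<in> VF" "y \<in> VF"
  shows "Nhat1 M D x y = 0" "Nhat2 M D x y = 0" "Nhat3 M D x = 0" "Nhat4 M D x = 0"
proof -
  define S where "S u v =
      (1/4) *\<^sub>R (b_tensor M D u v - b_tensor M D v u + c_tensor M D u v - c_tensor M D v u)" for u v
  have "vertical 1 S"
    unfolding vertical_def
  proof (intro conjI ballI)
    show "F u v w = sq_ext M S u v w" if "u \<in> VF" "v \<in> VF" "w \<in> VF" for u v w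
      using F_class[OF C that] unfolding F_comp_def Let_def
      by (simp add: sq_ext_def S_def) (intro ext, simp add: algebra_simps)
    show "S u \<xi> = 0" "S \<xi> u = 0" if "u \<in> VF" for u
      using that by (simp_all add: S_def bc_tensor_phi)
    show "S (\<phi> u) (\<phi> v) = 1 *\<^sub>R S u v" if "u \<in> VF" "v \<in> VF" for u v
      using that by (simp add: S_def bc_tensor_phi)
  qed
  note N = Nhat_vertical[OF this]
  have F_anti: "F v u \<xi> = - F u v \<xi>" if "u \<in> VF" "v \<in> VF" for u v
  proof -
    have "S v u = - S u v"
      unfolding S_def by (simp add: scaleR_minus_right[symmetric] del: scaleR_minus_right)
    then show ?thesis using N(1) that by simp
  qed
  have "F y (\<phi> x) \<xi> = - F x (\<phi> y) \<xi>"
    using F_anti[of "\<phi> x" y] N(2)[OF VF] VF by simp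
  then show "Nhat1 M D x y = 0"
    by (intro Nhat1_eq_0I) (use N(3)[OF VF] VF in simp_all)
  show "Nhat2 M D x y = 0"
    using N(4)[OF VF] F_anti[OF VF] by simp
  show "Nhat3 M D x = 0"
    by (rule Nhat3_eq_0I) (use N(5)[OF VF] VF in simp_all)
  show "Nhat4 M D x = 0"
    by (rule N(6)[OF VF])
qed

text \<open>
  With $e = -1$ the terms of $\widehat N^{(1)}$ in which the symmetry of \<open>S\<close> would matter drop out, so the
  symmetric and the antisymmetric case give the same formulas.
\<close>

lemma Nhat_class_8_9:
  assumes C: "in_basic_class n M D 8 \<or> in_basic_class n M D 9" and VF: "x \<in> VF" "y \<in> VF"
  shows "z \<in> VF \<Longrightarrow> Nhat1_cov M D x y z =
      (-2) *\<^sub>R (\<eta> x * F y (\<phi> z) \<xi> + \<eta> y * F x (\<phi> z) \<xi>)"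
    and "Nhat2 M D x y = 0"
    and "Nhat3_cov M D x y = 2 *\<^sub>R F x y \<xi>"
    and "Nhat4 M D x = 0"
proof -
  \<comment> \<open>The sign \<open>s\<close> is all that distinguishes the two classes.\<close>
  define s :: real where "s = (if in_basic_class n M D 8 then 1 else -1)"
  define S where "S u v = (1/4) *\<^sub>R (b_tensor M D u v - c_tensor M D u v
        + s *\<^sub>R (b_tensor M D v u - c_tensor M D v u))" for u v
  have "vertical (-1) S"
    unfolding vertical_def
  proof (intro conjI ballI)
    show "F u v w = sq_ext M S u v w" if "u \<in> VF" "v \<in> VF" "w \<in> VF" for u v w
    proof (cases "in_basic_class n M D 8")
      case True
      show ?thesis
        using F_class[OF True that] True unfolding F_comp_def Let_def
        by (simp add: sq_ext_def S_def s_def) (intro ext, simp add: algebra_simps)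
    next
      case False
      then have "in_basic_class n M D 9" using C by blast
      from F_class[OF this that] False show ?thesis
        unfolding F_comp_def Let_def
        by (simp add: sq_ext_def S_def s_def) (intro ext, simp add: algebra_simps)
    qed
    show "S u \<xi> = 0" "S \<xi> u = 0" if "u \<in> VF" for u
      using that by (simp_all add: S_def bc_tensor_phi)
    show "S (\<phi> u) (\<phi> v) = (-1) *\<^sub>R S u v" if "u \<in> VF" "v \<in> VF" for u v
      using that by (simp add: S_def bc_tensor_phi) (intro ext, simp add: algebra_simps)
  qed
  note N = Nhat_vertical[OF this VF]
  show "Nhat1_cov M D x y z = (-2) *\<^sub>R (\<eta> x * F y (\<phi> z) \<xi> + \<eta> y * F x (\<phi> z) \<xi>)" if "z \<in> VF"
    using N(3)[OF that] by simp
  show "Nhat2 M D x y = 0" "Nhat4 M D x = 0"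
    using N(4,6) by simp_all
  show "Nhat3_cov M D x y = 2 *\<^sub>R F x y \<xi>"
    using N(5)[OF VF(2)] by simp
qed

section \<open>Fundamental tensors concentrated along the Reeb field\<close>

lemma Nhat_class_10:
  assumes C: "in_basic_class n M D 10" and VF: "x \<in> VF" "y \<in> VF"
  shows "z \<in> VF \<Longrightarrow> Nhat1_cov M D x y z =
      - (\<eta> x * F \<xi> y (\<phi> z)) - \<eta> y * F \<xi> x (\<phi> z)"
    and "Nhat2 M D x y = 0"
    and "Nhat3_cov M D x y = F \<xi> x y"
    and "Nhat4 M D x = 0"
proof -
  have K: "F u v w = \<eta> u * F \<xi> (\<phi> (\<phi> v)) (\<phi> (\<phi> w))" if "u \<in> VF" "v \<in> VF" "w \<in> VF" for u v w
    using F_class[OF C that] by (simp add: F_comp_def Let_def)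
  have F_eta: "F u v w = \<eta> u * F \<xi> v w" if "u \<in> VF" "v \<in> VF" "w \<in> VF" for u v w
    using K[OF that] K[of \<xi> v w] that by simp
  have F_xi: "F u v \<xi> = 0" "F u \<xi> v = 0" if "u \<in> VF" "v \<in> VF" for u v
    using K[of u v \<xi>] K[of u \<xi> v] that by simp_all
  have eq: "F x y (\<phi> z) = \<eta> x * F \<xi> y (\<phi> z)" "F y x (\<phi> z) = \<eta> y * F \<xi> x (\<phi> z)"
    "F (\<phi> x) y z = 0" "F (\<phi> y) x z = 0" if "z \<in> VF" for z
    using that VF F_eta[of x y "\<phi> z"] F_eta[of y x "\<phi> z"] F_eta[of "\<phi> x" y z] F_eta[of "\<phi> y" x z]
    by simp_all
  show "Nhat1_cov M D x y z = - (\<eta> x * F \<xi> y (\<phi> z)) - \<eta> y * F \<xi> x (\<phi> z)" if "z \<in> VF"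
    using VF that by (simp add: Nhat1_cov_F F_xi eq)
  show "Nhat2 M D x y = 0" "Nhat3_cov M D x y = F \<xi> x y" "Nhat4 M D x = 0"
    using VF by (simp_all add: Nhat2_F Nhat3_cov_F Nhat4_F omega_def F_xi)
qed

lemma Nhat_class_11:
  assumes C: "in_basic_class n M D 11" and VF: "x \<in> VF" "y \<in> VF"
  shows "z \<in> VF \<Longrightarrow> Nhat1_cov M D x y z =
      \<eta> z * (\<eta> x * omega M D (\<phi> y) + \<eta> y * omega M D (\<phi> x))
      - 2 *\<^sub>R (\<eta> x * \<eta> y * omega M D (\<phi> z))"
    and "Nhat2 M D x y = - (\<eta> x * omega M D y) - \<eta> y * omega M D x"
    and "Nhat3_cov M D x y = omega M D x * \<eta> y + 2 *\<^sub>R (\<eta> x * omega M D y)"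
    and "Nhat4 M D x = - omega M D (\<phi> x)"
proof -
  have K: "F u v w = \<eta> u * (\<eta> v * omega M D w + \<eta> w * omega M D v)"
    if "u \<in> VF" "v \<in> VF" "w \<in> VF" for u v w
    using F_class[OF C that] by (simp add: F_comp_def Let_def)
  have omega_xi: "omega M D \<xi> = 0"
    by (simp add: omega_def F_xi_xi)
  have omega_phi_phi: "omega M D (\<phi> (\<phi> u)) = omega M D u" if "u \<in> VF" for u
    using that by (simp add: omega_def F_phi_phi_3 F_xi_xi)
  show "Nhat1_cov M D x y z =
      \<eta> z * (\<eta> x * omega M D (\<phi> y) + \<eta> y * omega M D (\<phi> x))
      - 2 *\<^sub>R (\<eta> x * \<eta> y * omega M D (\<phi> z))" if "z \<in> VF"
    using VF that by (simp add: Nhat1_cov_F K omega_xi) (intro ext, simp add: algebra_simps)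
  show "Nhat2 M D x y = - (\<eta> x * omega M D y) - \<eta> y * omega M D x"
    using VF by (simp add: Nhat2_F K omega_xi omega_phi_phi)
  show "Nhat3_cov M D x y = omega M D x * \<eta> y + 2 *\<^sub>R (\<eta> x * omega M D y)"
    using VF by (simp add: Nhat3_cov_F K omega_xi) (intro ext, simp add: algebra_simps)
  show "Nhat4 M D x = - omega M D (\<phi> x)"
    by (rule Nhat4_F[OF VF(1)])
qed

end

section \<open>The eleven basic classes\<close>

theorem proposition6p3:
  fixes n :: nat
    and M :: "('m::{t2_space,second_countable_topology}, 'e::euclidean_space) apapr_structure"
    and D :: "'m vfield \<Rightarrow> 'm vfield \<Rightarrow> 'm vfield"
    and x y z :: "'m vfield"
  assumes "n \<ge> 1"
    and "apapr_manifold n M"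
    and "levi_civita_connection (atlas M) (metric M) D"
    and "x \<in> vector_fields (atlas M)"
    and "y \<in> vector_fields (atlas M)"
    and "z \<in> vector_fields (atlas M)"
  shows
    "(in_basic_class n M D 1 \<longrightarrow>
        Nhat1_cov M D x y z =
          (2 / real n) *\<^sub>R (vg M x (vphi M y) * theta n M D (vphi M (vphi M z))
                          - vg M (vphi M x) (vphi M y) * theta n M D (vphi M z)) \<and>
        Nhat2 M D x y = 0 \<and> Nhat3 M D x = 0 \<and> Nhat4 M D x = 0) \<and>
     (in_basic_class n M D 2 \<longrightarrow>
        Nhat1_cov M D x y z =
          (-2) *\<^sub>R (fundamental_F M D (vphi M x) (vphi M y) (vphi M z)
                  + fundamental_F M D (vphi M (vphi M x)) (vphi M (vphi M y)) (vphi M z)) \<and>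
        Nhat2 M D x y = 0 \<and> Nhat3 M D x = 0 \<and> Nhat4 M D x = 0) \<and>
     (in_basic_class n M D 3 \<or> in_basic_class n M D 7 \<longrightarrow>
        Nhat1 M D x y = 0 \<and> Nhat2 M D x y = 0 \<and> Nhat3 M D x = 0 \<and> Nhat4 M D x = 0) \<and>
     (in_basic_class n M D 4 \<longrightarrow>
        Nhat1_cov M D x y z =
          (2 / real n) *\<^sub>R (theta n M D (xi M) * vg M x (vphi M y) * veta M z) \<and>
        Nhat2 M D x y =
          (- 2 / real n) *\<^sub>R (theta n M D (xi M) * vg M (vphi M x) (vphi M y)) \<and>
        Nhat3 M D x = 0 \<and> Nhat4 M D x = 0) \<and>
     (in_basic_class n M D 5 \<longrightarrow>
        Nhat1_cov M D x y z =
          (2 / real n) *\<^sub>R (theta_star n M D (xi M) * vg M (vphi M x) (vphi M y) * veta M z) \<and>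
        Nhat2 M D x y =
          (- 2 / real n) *\<^sub>R (theta_star n M D (xi M) * vg M x (vphi M y)) \<and>
        Nhat3 M D x = 0 \<and> Nhat4 M D x = 0) \<and>
     (in_basic_class n M D 6 \<longrightarrow>
        Nhat1_cov M D x y z = 4 *\<^sub>R (fundamental_F M D x (vphi M y) (xi M) * veta M z) \<and>
        Nhat2 M D x y = (-4) *\<^sub>R fundamental_F M D x y (xi M) \<and>
        Nhat3 M D x = 0 \<and> Nhat4 M D x = 0) \<and>
     (in_basic_class n M D 8 \<or> in_basic_class n M D 9 \<longrightarrow>
        Nhat1_cov M D x y z =
          (-2) *\<^sub>R (veta M x * fundamental_F M D y (vphi M z) (xi M)
                  + veta M y * fundamental_F M D x (vphi M z) (xi M)) \<and>
        Nhat2 M D x y = 0 \<and>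
        Nhat3_cov M D x y = 2 *\<^sub>R fundamental_F M D x y (xi M) \<and>
        Nhat4 M D x = 0) \<and>
     (in_basic_class n M D 10 \<longrightarrow>
        Nhat1_cov M D x y z =
          - (veta M x * fundamental_F M D (xi M) y (vphi M z))
          - veta M y * fundamental_F M D (xi M) x (vphi M z) \<and>
        Nhat2 M D x y = 0 \<and>
        Nhat3_cov M D x y = fundamental_F M D (xi M) x y \<and>
        Nhat4 M D x = 0) \<and>
     (in_basic_class n M D 11 \<longrightarrow>
        Nhat1_cov M D x y z =
          veta M z * (veta M x * omega M D (vphi M y) + veta M y * omega M D (vphi M x))
          - 2 *\<^sub>R (veta M x * veta M y * omega M D (vphi M z)) \<and>
        Nhat2 M D x y = - (veta M x * omega M D y) - veta M y * omega M D x \<and>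
        Nhat3_cov M D x y = omega M D x * veta M y + 2 *\<^sub>R (veta M x * omega M D y) \<and>
        Nhat4 M D x = - omega M D (vphi M x))"
proof -
  interpret apapr_levi_civita n M D
    using assms(2,3) by unfold_locales
  have class_3_7: "Nhat1 M D x y = 0" "Nhat2 M D x y = 0" "Nhat3 M D x = 0" "Nhat4 M D x = 0"
    if "in_basic_class n M D 3 \<or> in_basic_class n M D 7"
    using that Nhat_class_3[OF _ assms(4,5)] Nhat_class_7[OF _ assms(4,5)] by blast+
  show ?thesis
    by (intro conjI impI;
        (rule Nhat_class_1 Nhat_class_2 class_3_7 Nhat_class_4 Nhat_class_5 Nhat_class_6
          Nhat_class_8_9 Nhat_class_10 Nhat_class_11;
        (assumption | rule assms(4-6))))
qed

end
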